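(* Let $T=(T_1,\ldots,T_n)\in\mathfrak{B}^n_0(\mathcal{H})$ and let the BCL $n$-tuple $(M_{\Phi_1},\ldots,M_{\Phi_n})\in\mathfrak{B}^n_0(H^2_{\mathcal{E}}(\mathbb{D}))$ be an isometric dilation of $T$ for some Hilbert space $\mathcal{E}$, with dilation map $\Pi$; that is, $\Pi:\mathcal{H}\to H^2_{\mathcal{E}}(\mathbb{D})$ is an isometry with $\Pi T_i^*=M_{\Phi_i}^*\Pi$ for $i=1,\ldots,n$. If $X\in\mathcal{B}(\mathcal{H})$ is a contraction with $XT_i=T_iX$ for $i=1,\ldots,n$, then there exists $Y\in\mathcal{B}(H^2_{\mathcal{E}}(\mathbb{D}))$ such that $Y$ is a lift of $X$, i.e. $\Pi X^*=Y^*\Pi$, and $$YM_{\Phi_i}=M_{\Phi_i}Y\quad(i=1,\ldots,n),\qquad \|Y\|=\|X\|.$$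
   Context: All Hilbert spaces are complex and separable; $\mathcal{B}(\mathcal{H})$ is the algebra of bounded operators on $\mathcal{H}$; $n\ge 2$; $\mathbb{D}$ is the open unit disc. A contraction $S$ is called pure if $S^{*k}\to 0$ in the strong operator topology as $k\to\infty$. The class $\mathfrak{B}^n_0(\mathcal{H})$ is the set of all $n$-tuples $T=(T_1,\ldots,T_n)$ of commuting contractions on $\mathcal{H}$ such that $I-T_iT_i^*-T_jT_j^*+T_iT_jT_i^*T_j^*=0$ for all $i\neq j$, and the product $T_1\cdots T_n$ is pure. $H^2_{\mathcal{E}}(\mathbb{D})$ is the $\mathcal{E}$-valued Hardy space on $\mathbb{D}$, and for a bounded analytic function $\Phi:\mathbb{D}\to\mathcal{B}(\mathcal{E})$, $M_\Phi$ is the multiplication operator $(M_\Phi f)(z)=\Phi(z)f(z)$. A BCL $n$-tuple on $H^2_{\mathcal{E}}(\mathbb{D})$ is an $n$-tuple of commuting isometries $(M_{\Phi_1},\ldots,M_{\Phi_n})$, with $\Phi_i$ bounded analytic $\mathcal{B}(\mathcal{E})$-valued functions, such that $M_{\Phi_1}\cdots M_{\Phi_n}=M_z$ (the shift). By the Berger–Coburn–Lebow theorem such $\Phi_i$ have the form $\Phi_i(z)=U_i(P_i^\perp+zP_i)$ with $U_i$ unitary and $P_i$ an orthogonal projection on $\mathcal{E}$. *)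

theory Defs
  imports "HOL-Analysis.Analysis"
begin

section \<open>Complex Hilbert spaces\<close>

class complex_vector = real_vector +
  fixes scaleC :: "complex \<Rightarrow> 'a \<Rightarrow> 'a"  (infixr "*\<^sub>C" 75)
  assumes scaleC_add_right: "c *\<^sub>C (x + y) = c *\<^sub>C x + c *\<^sub>C y"
    and scaleC_add_left: "(c + d) *\<^sub>C x = c *\<^sub>C x + d *\<^sub>C x"
    and scaleC_scaleC: "c *\<^sub>C d *\<^sub>C x = (c * d) *\<^sub>C x"
    and scaleC_one: "1 *\<^sub>C x = x"
    and scaleR_scaleC: "r *\<^sub>R x = complex_of_real r *\<^sub>C x"

text \<open>
  The complex inner product is linear in its first argument.  Its real part is the
  \<^const>\<open>inner\<close> of class \<^class>\<open>real_inner\<close>; positive definiteness, norm and topology are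
  inherited from that class.
\<close>

class complex_inner = complex_vector + real_inner +
  fixes cinner :: "'a \<Rightarrow> 'a \<Rightarrow> complex"
  assumes cinner_commute: "cinner x y = cnj (cinner y x)"
    and cinner_add_left: "cinner (x + y) z = cinner x z + cinner y z"
    and cinner_scaleC_left: "cinner (c *\<^sub>C x) y = c * cinner x y"
    and inner_eq_Re_cinner: "inner x y = Re (cinner x y)"

class chilbert_space = complex_inner + complete_space

instance chilbert_space \<subseteq> banach ..

lemma cinner_add_right: "cinner x (y + z) = cinner x y + cinner x z"
  for x y z :: "'a::complex_inner"
  by (metis cinner_commute cinner_add_left complex_cnj_add)

lemma cinner_scaleC_right: "cinner x (c *\<^sub>C y) = cnj c * cinner x y"
  for x y :: "'a::complex_inner"
  by (metis cinner_commute cinner_scaleC_left complex_cnj_mult)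

lemma cinner_self: "cinner x x = complex_of_real ((norm x)\<^sup>2)" for x :: "'a::complex_inner"
proof -
  have "Im (cinner x x) = 0"
    using cinner_commute[of x x] by (metis add.inverse_neutral cnj.simps(2) equal_neg_zero)
  moreover have "Re (cinner x x) = (norm x)\<^sup>2"
    by (metis inner_eq_Re_cinner power2_norm_eq_inner)
  ultimately show ?thesis by (simp add: complex_eq_iff)
qed

lemma norm_scaleC: "norm (c *\<^sub>C x) = cmod c * norm x" for x :: "'a::complex_inner"
proof -
  have "complex_of_real ((norm (c *\<^sub>C x))\<^sup>2) = c * cnj c * complex_of_real ((norm x)\<^sup>2)"
    by (simp only: cinner_self[symmetric] cinner_scaleC_left cinner_scaleC_right) simp
  also have "\<dots> = complex_of_real ((cmod c * norm x)\<^sup>2)"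
    by (simp add: complex_norm_square[symmetric] power_mult_distrib)
  finally have "(norm (c *\<^sub>C x))\<^sup>2 = (cmod c * norm x)\<^sup>2"
    using of_real_eq_iff by blast
  then show ?thesis by (simp add: power2_eq_iff_nonneg)
qed

lemma bounded_linear_scaleC: "bounded_linear (\<lambda>x::'a::complex_inner. c *\<^sub>C x)"
proof (rule bounded_linear_intro[where K = "cmod c"])
  show "c *\<^sub>C (r *\<^sub>R x) = r *\<^sub>R (c *\<^sub>C x)" for r and x :: 'a
    by (simp add: scaleR_scaleC scaleC_scaleC mult.commute)
qed (simp_all add: scaleC_add_right norm_scaleC)

lemma norm_cinner_le: "cmod (cinner x y) \<le> norm x * norm y" for x y :: "'a::complex_inner"
proof (cases "cinner x y = 0")
  case False
  define c where "c = cnj (cinner x y) / complex_of_real (cmod (cinner x y))"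
  have c: "cmod c = 1" using False by (simp add: c_def norm_divide)
  have "cinner (c *\<^sub>C x) y = complex_of_real (cmod (cinner x y))"
    using False complex_norm_square[of "cinner x y"]
    by (simp add: cinner_scaleC_left c_def field_simps power2_eq_square)
  then have "cmod (cinner x y) = inner (c *\<^sub>C x) y" by (simp add: inner_eq_Re_cinner)
  also have "\<dots> \<le> norm (c *\<^sub>C x) * norm y" by (rule norm_cauchy_schwarz)
  finally show ?thesis by (simp add: norm_scaleC c)
qed simp

lemma bounded_linear_cinner_left: "bounded_linear (\<lambda>x::'a::complex_inner. cinner x y)"
proof (rule bounded_linear_intro[where K = "norm y"])
  show "cinner (r *\<^sub>R x) y = r *\<^sub>R cinner x y" for r and x :: 'a
    by (simp add: scaleR_scaleC cinner_scaleC_left scaleR_conv_of_real)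
qed (simp_all add: cinner_add_left norm_cinner_le)


section \<open>Operators\<close>

text \<open>
  Elements of \<open>\<B>(\<H>)\<close> are functions satisfying the following predicate; their operator norm
  is the library's \<^const>\<open>onorm\<close>.
\<close>

definition bounded_clinear :: "('a::complex_inner \<Rightarrow> 'b::complex_inner) \<Rightarrow> bool" where
  "bounded_clinear A \<longleftrightarrow> bounded_linear A \<and> (\<forall>c x. A (c *\<^sub>C x) = c *\<^sub>C A x)"

definition cadjoint :: "('a::complex_inner \<Rightarrow> 'b::complex_inner) \<Rightarrow> 'b \<Rightarrow> 'a" where
  "cadjoint A = (SOME B. \<forall>x y. cinner (A x) y = cinner x (B y))"

definition contraction :: "('a::complex_inner \<Rightarrow> 'a) \<Rightarrow> bool" where
  "contraction A \<longleftrightarrow> bounded_clinear A \<and> onorm A \<le> 1"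

definition linear_isometry :: "('a::complex_inner \<Rightarrow> 'b::complex_inner) \<Rightarrow> bool" where
  "linear_isometry A \<longleftrightarrow> bounded_clinear A \<and> (\<forall>x. norm (A x) = norm x)"

definition pure_contraction :: "('a::complex_inner \<Rightarrow> 'a) \<Rightarrow> bool" where
  "pure_contraction A \<longleftrightarrow> contraction A \<and> (\<forall>x. (\<lambda>k. (cadjoint A ^^ k) x) \<longlonglongrightarrow> 0)"

text \<open>
  An \<open>n\<close>-tuple of operators is a family indexed by \<^typ>\<open>nat\<close> of which only the members with
  index in \<open>{1..n}\<close> matter.  The product is \<open>T 1 \<circ> T 2 \<circ> \<dots> \<circ> T n\<close>.
\<close>

definition tuple_prod :: "nat \<Rightarrow> (nat \<Rightarrow> 'a \<Rightarrow> 'a) \<Rightarrow> 'a \<Rightarrow> 'a" where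
  "tuple_prod n T = foldr (\<circ>) (map T [1..<Suc n]) id"

definition commuting_tuple :: "nat \<Rightarrow> (nat \<Rightarrow> 'a \<Rightarrow> 'a) \<Rightarrow> bool" where
  "commuting_tuple n T \<longleftrightarrow> (\<forall>i\<in>{1..n}. \<forall>j\<in>{1..n}. T i \<circ> T j = T j \<circ> T i)"

definition class_B0 :: "nat \<Rightarrow> (nat \<Rightarrow> 'a::complex_inner \<Rightarrow> 'a) set" where
  "class_B0 n = {T.
     (\<forall>i\<in>{1..n}. contraction (T i)) \<and>
     commuting_tuple n T \<and>
     (\<forall>i\<in>{1..n}. \<forall>j\<in>{1..n}. i \<noteq> j \<longrightarrow>
        (\<forall>x. x - T i (cadjoint (T i) x) - T j (cadjoint (T j) x)
              + T i (T j (cadjoint (T i) (cadjoint (T j) x))) = 0)) \<and>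
     pure_contraction (tuple_prod n T)}"


section \<open>The Hardy space\<close>

text \<open>
  \<open>H\<^sup>2\<^sub>\<E>(\<D>)\<close> consists of the functions \<open>f(z) = \<Sum>\<^sub>k z\<^sup>k a\<^sub>k\<close> on the open unit disc with
  \<open>\<Sum>\<^sub>k \<parallel>a\<^sub>k\<parallel>\<^sup>2 < \<infinity>\<close>.  As HOL functions are total, such a function is represented by its extension
  by zero to the complement of the disc.
\<close>

definition hardy_coeffs :: "(nat \<Rightarrow> 'e::chilbert_space) \<Rightarrow> (complex \<Rightarrow> 'e) \<Rightarrow> bool" where
  "hardy_coeffs a f \<longleftrightarrow>
     summable (\<lambda>k. (norm (a k))\<^sup>2) \<and> (\<forall>z\<in>ball 0 1. (\<lambda>k. z ^ k *\<^sub>C a k) sums f z)"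

definition hardy_set :: "(complex \<Rightarrow> 'e::chilbert_space) set" where
  "hardy_set = {f. (\<exists>a. hardy_coeffs a f) \<and> (\<forall>z. z \<notin> ball 0 1 \<longrightarrow> f z = 0)}"

lemma square_summable_lincomb:
  fixes a b :: "nat \<Rightarrow> 'e::complex_inner"
  assumes "summable (\<lambda>k. (norm (a k))\<^sup>2)" "summable (\<lambda>k. (norm (b k))\<^sup>2)"
  shows "summable (\<lambda>k. (norm (c *\<^sub>C a k + d *\<^sub>C b k))\<^sup>2)"
proof (rule summable_comparison_test')
  show "summable (\<lambda>k. 2 * (cmod c)\<^sup>2 * (norm (a k))\<^sup>2 + 2 * (cmod d)\<^sup>2 * (norm (b k))\<^sup>2)"
    using assms by (intro summable_add summable_mult)
  fix k :: nat assume "k \<ge> 0"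
  have "(norm (c *\<^sub>C a k + d *\<^sub>C b k))\<^sup>2 \<le> (cmod c * norm (a k) + cmod d * norm (b k))\<^sup>2"
    by (intro power_mono) (metis norm_scaleC norm_triangle_ineq, simp)
  also have "\<dots> \<le> 2 * (cmod c * norm (a k))\<^sup>2 + 2 * (cmod d * norm (b k))\<^sup>2"
    using zero_le_power2[of "cmod c * norm (a k) - cmod d * norm (b k)"]
    by (simp add: power2_sum power2_diff)
  finally show "norm ((norm (c *\<^sub>C a k + d *\<^sub>C b k))\<^sup>2)
      \<le> 2 * (cmod c)\<^sup>2 * (norm (a k))\<^sup>2 + 2 * (cmod d)\<^sup>2 * (norm (b k))\<^sup>2"
    by (simp add: power_mult_distrib mult.assoc)
qed

lemma hardy_coeffs_lincomb:
  assumes "hardy_coeffs a f" "hardy_coeffs b g"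
  shows "hardy_coeffs (\<lambda>k. c *\<^sub>C a k + d *\<^sub>C b k) (\<lambda>z. c *\<^sub>C f z + d *\<^sub>C g z)"
  unfolding hardy_coeffs_def
proof (intro conjI ballI)
  show "summable (\<lambda>k. (norm (c *\<^sub>C a k + d *\<^sub>C b k))\<^sup>2)"
    using assms by (intro square_summable_lincomb) (simp_all add: hardy_coeffs_def)
  fix z :: complex assume z: "z \<in> ball 0 1"
  have "(\<lambda>k. c *\<^sub>C z ^ k *\<^sub>C a k) sums (c *\<^sub>C f z)" "(\<lambda>k. d *\<^sub>C z ^ k *\<^sub>C b k) sums (d *\<^sub>C g z)"
    using assms z by (auto simp: hardy_coeffs_def intro!: bounded_linear.sums[OF bounded_linear_scaleC])
  from sums_add[OF this]
  show "(\<lambda>k. z ^ k *\<^sub>C (c *\<^sub>C a k + d *\<^sub>C b k)) sums (c *\<^sub>C f z + d *\<^sub>C g z)"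
    by (simp add: scaleC_add_right scaleC_scaleC mult.commute)
qed

lemma scaleC_zero_left: "0 *\<^sub>C x = 0" for x :: "'a::complex_vector"
  using scaleC_add_left[of 0 0 x] by simp

lemma scaleC_zero_right: "c *\<^sub>C 0 = 0" for c :: complex
  using scaleC_add_right[of c "0::'a::complex_vector" 0] by simp

lemma scaleC_minus1: "(-1) *\<^sub>C x = - x" for x :: "'a::complex_vector"
  using scaleR_scaleC[of "-1" x] by simp

lemma hardy_coeffs_zero: "hardy_coeffs (\<lambda>_. 0) (\<lambda>_. 0)"
  by (simp add: hardy_coeffs_def scaleC_zero_right)

lemma hardy_set_lincomb:
  "f \<in> hardy_set \<Longrightarrow> g \<in> hardy_set \<Longrightarrow> (\<lambda>z. c *\<^sub>C f z + d *\<^sub>C g z) \<in> hardy_set"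
  using hardy_coeffs_lincomb by (fastforce simp: hardy_set_def scaleC_zero_right)

lemma hardy_set_zero: "(\<lambda>_. 0) \<in> hardy_set"
  using hardy_coeffs_zero by (auto simp: hardy_set_def)

typedef (overloaded) 'e hardy = "hardy_set :: (complex \<Rightarrow> 'e::chilbert_space) set"
  morphisms hardy_fun Abs_hardy
  using hardy_set_zero by blast

lemma hardy_coeffs_zeroD:
  assumes "hardy_coeffs a f" "\<And>z. z \<in> ball 0 1 \<Longrightarrow> f z = 0"
  shows "a k = 0"
proof -
  have "cinner (a k) e = 0" for e
  proof -
    define F where "F = Abs_fps (\<lambda>k. cinner (a k) e)"
    have s: "(\<lambda>k. cinner (a k) e * z ^ k) sums 0" if "z \<in> ball 0 1" for z
    proof -
      have "(\<lambda>k. cinner (z ^ k *\<^sub>C a k) e) sums cinner (f z) e"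
        using assms that by (auto simp: hardy_coeffs_def intro!: bounded_linear.sums[OF bounded_linear_cinner_left])
      then show ?thesis
        using assms(2)[OF that] cinner_scaleC_left[of 0 0 e]
        by (simp add: cinner_scaleC_left mult.commute scaleC_zero_left)
    qed
    have "ereal (1/2) \<le> fps_conv_radius F"
      using conv_radius_geI[OF sums_summable[OF s[of "1/2"]]]
      by (simp add: fps_conv_radius_def F_def del: ereal_divide)
    then have r: "fps_conv_radius F > 0"
      by (rule less_le_trans[rotated]) simp
    have "eventually (\<lambda>z. eval_fps F z = eval_fps 0 z) (nhds 0)"
    proof -
      have "eventually (\<lambda>z. z \<in> ball 0 1) (nhds (0::complex))"
        by (intro eventually_nhds_in_open) auto
      then show ?thesis
        by eventually_elim (use s in \<open>auto simp: eval_fps_def F_def sums_iff\<close>)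
    qed
    then have "F = 0" using r by (intro eval_fps_eqD) auto
    then show ?thesis by (metis F_def fps_nth_Abs_fps fps_zero_nth)
  qed
  from this[of "a k"] show ?thesis by (simp add: cinner_self)
qed

lemma hardy_coeffs_unique:
  assumes "hardy_coeffs a f" "hardy_coeffs b f"
  shows "a = b"
proof
  fix k
  have "1 *\<^sub>C a k + (-1) *\<^sub>C b k = 0"
    using hardy_coeffs_lincomb[OF assms, of 1 "-1"]
    by (rule hardy_coeffs_zeroD) (simp add: scaleC_one scaleC_minus1)
  then show "a k = b k" by (simp add: scaleC_one scaleC_minus1)
qed

definition hardy_coeff :: "'e::chilbert_space hardy \<Rightarrow> nat \<Rightarrow> 'e" where
  "hardy_coeff f = (THE a. hardy_coeffs a (hardy_fun f))"

lemma hardy_coeff_eqI: "hardy_coeffs a (hardy_fun f) \<Longrightarrow> hardy_coeff f = a"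
  unfolding hardy_coeff_def by (rule the_equality) (auto intro: hardy_coeffs_unique)

lemma hardy_coeffs_coeff: "hardy_coeffs (hardy_coeff f) (hardy_fun f)"
  using hardy_fun[of f] hardy_coeff_eqI by (auto simp: hardy_set_def)

lemma hardy_coeff_summable: "summable (\<lambda>k. (norm (hardy_coeff f k))\<^sup>2)"
  using hardy_coeffs_coeff by (auto simp: hardy_coeffs_def)

lemma hardy_fun_outside: "z \<notin> ball 0 1 \<Longrightarrow> hardy_fun f z = 0"
  using hardy_fun[of f] by (auto simp: hardy_set_def)

lemma hardy_coeff_inject:
  assumes "hardy_coeff f = hardy_coeff g"
  shows "f = g"
proof -
  have "hardy_fun f z = hardy_fun g z" for z
  proof (cases "z \<in> ball 0 1")
    case True
    then show ?thesis
      using hardy_coeffs_coeff[of f] hardy_coeffs_coeff[of g] assms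
      unfolding hardy_coeffs_def by (metis sums_unique2)
  qed (simp only: hardy_fun_outside not_False_eq_True)
  then show ?thesis by (metis ext hardy_fun_inject)
qed

lemma prod_le_sum_squares: "0 \<le> x \<Longrightarrow> 0 \<le> y \<Longrightarrow> x * y \<le> x\<^sup>2 + y\<^sup>2" for x y :: real
  using sum_squares_bound[of x y] mult_nonneg_nonneg[of x y] by linarith

lemma hardy_coeff_surj:
  fixes a :: "nat \<Rightarrow> 'e::chilbert_space"
  assumes a: "summable (\<lambda>k. (norm (a k))\<^sup>2)"
  shows "\<exists>f. hardy_coeff f = a"
proof -
  define F where "F = (\<lambda>z. if z \<in> ball 0 1 then (\<Sum>k. z ^ k *\<^sub>C a k) else 0)"
  have "(\<lambda>k. z ^ k *\<^sub>C a k) sums F z" if z: "z \<in> ball 0 1" for z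
  proof -
    have z2: "(cmod z)\<^sup>2 < 1" using z by (simp add: power_less_one_iff abs_square_less_1)
    have "summable (\<lambda>k. z ^ k *\<^sub>C a k)"
    proof (rule summable_comparison_test')
      show "summable (\<lambda>k. ((cmod z)\<^sup>2) ^ k + (norm (a k))\<^sup>2)"
        using a z2 by (intro summable_add summable_geometric) auto
      fix k :: nat assume "k \<ge> 0"
      have "norm (z ^ k *\<^sub>C a k) = cmod z ^ k * norm (a k)" by (simp add: norm_scaleC norm_power)
      also have "\<dots> \<le> (cmod z ^ k)\<^sup>2 + (norm (a k))\<^sup>2"
        by (rule prod_le_sum_squares) simp_all
      finally show "norm (z ^ k *\<^sub>C a k) \<le> ((cmod z)\<^sup>2) ^ k + (norm (a k))\<^sup>2"
        by (simp add: power_mult[symmetric] mult.commute)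
    qed
    then show ?thesis using z by (simp add: F_def summable_sums)
  qed
  then have F: "hardy_coeffs a F" using a by (simp add: hardy_coeffs_def)
  then have "F \<in> hardy_set" by (auto simp: hardy_set_def F_def)
  then have "hardy_coeff (Abs_hardy F) = a"
    using F by (intro hardy_coeff_eqI) (simp add: Abs_hardy_inverse)
  then show ?thesis ..
qed

lemma summable_cinner:
  fixes a b :: "nat \<Rightarrow> 'e::complex_inner"
  assumes "summable (\<lambda>k. (norm (a k))\<^sup>2)" "summable (\<lambda>k. (norm (b k))\<^sup>2)"
  shows "summable (\<lambda>k. cinner (a k) (b k))"
proof (rule summable_comparison_test')
  show "summable (\<lambda>k. (norm (a k))\<^sup>2 + (norm (b k))\<^sup>2)" using assms by (rule summable_add)
  fix k :: nat assume "k \<ge> 0"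
  show "norm (cinner (a k) (b k)) \<le> (norm (a k))\<^sup>2 + (norm (b k))\<^sup>2"
    using norm_cinner_le[of "a k" "b k"] prod_le_sum_squares[of "norm (a k)" "norm (b k)"] by simp
qed

instantiation hardy :: (chilbert_space) complex_inner
begin

definition zero_hardy :: "'a hardy" where
  "0 = Abs_hardy (\<lambda>_. 0)"

definition plus_hardy :: "'a hardy \<Rightarrow> 'a hardy \<Rightarrow> 'a hardy" where
  "f + g = Abs_hardy (\<lambda>z. hardy_fun f z + hardy_fun g z)"

definition minus_hardy :: "'a hardy \<Rightarrow> 'a hardy \<Rightarrow> 'a hardy" where
  "f - g = Abs_hardy (\<lambda>z. hardy_fun f z - hardy_fun g z)"

definition uminus_hardy :: "'a hardy \<Rightarrow> 'a hardy" where
  "- f = Abs_hardy (\<lambda>z. - hardy_fun f z)"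

definition scaleC_hardy :: "complex \<Rightarrow> 'a hardy \<Rightarrow> 'a hardy" where
  "c *\<^sub>C f = Abs_hardy (\<lambda>z. c *\<^sub>C hardy_fun f z)"

definition scaleR_hardy :: "real \<Rightarrow> 'a hardy \<Rightarrow> 'a hardy" where
  "r *\<^sub>R f = complex_of_real r *\<^sub>C f" for f :: "'a hardy"

definition cinner_hardy :: "'a hardy \<Rightarrow> 'a hardy \<Rightarrow> complex" where
  "cinner f g = (\<Sum>k. cinner (hardy_coeff f k) (hardy_coeff g k))"

definition inner_hardy :: "'a hardy \<Rightarrow> 'a hardy \<Rightarrow> real" where
  "inner f g = Re (cinner f g)" for f g :: "'a hardy"

definition norm_hardy :: "'a hardy \<Rightarrow> real" where
  "norm f = sqrt (inner f f)" for f :: "'a hardy"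

definition sgn_hardy :: "'a hardy \<Rightarrow> 'a hardy" where
  "sgn f = inverse (norm f) *\<^sub>R f" for f :: "'a hardy"

definition dist_hardy :: "'a hardy \<Rightarrow> 'a hardy \<Rightarrow> real" where
  "dist f g = norm (f - g)" for f g :: "'a hardy"

definition uniformity_hardy :: "('a hardy \<times> 'a hardy) filter" where
  "uniformity_hardy = (INF e\<in>{0 <..}. principal {(x, y). dist x y < e})"

definition open_hardy :: "'a hardy set \<Rightarrow> bool" where
  "open_hardy U \<longleftrightarrow> (\<forall>x\<in>U. eventually (\<lambda>(x', y). x' = x \<longrightarrow> y \<in> U) uniformity)"

lemma hardy_fun_simps:
  "hardy_fun (0::'a hardy) = (\<lambda>_. 0)"
  "hardy_fun (f + g) = (\<lambda>z. hardy_fun f z + hardy_fun g z)"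
  "hardy_fun (f - g) = (\<lambda>z. hardy_fun f z - hardy_fun g z)"
  "hardy_fun (- f) = (\<lambda>z. - hardy_fun f z)"
  "hardy_fun (c *\<^sub>C f) = (\<lambda>z. c *\<^sub>C hardy_fun f z)" for f g :: "'a hardy"
proof -
  show "hardy_fun (0::'a hardy) = (\<lambda>_. 0)"
    by (simp add: zero_hardy_def Abs_hardy_inverse hardy_set_zero)
  show "hardy_fun (f + g) = (\<lambda>z. hardy_fun f z + hardy_fun g z)"
    using hardy_set_lincomb[OF hardy_fun[of f] hardy_fun[of g], of 1 1]
    by (simp add: plus_hardy_def Abs_hardy_inverse scaleC_one)
  show "hardy_fun (f - g) = (\<lambda>z. hardy_fun f z - hardy_fun g z)"
    using hardy_set_lincomb[OF hardy_fun[of f] hardy_fun[of g], of 1 "-1"]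
    by (simp add: minus_hardy_def Abs_hardy_inverse scaleC_one scaleC_minus1)
  show "hardy_fun (- f) = (\<lambda>z. - hardy_fun f z)"
    using hardy_set_lincomb[OF hardy_fun[of f] hardy_fun[of f], of "-1" 0]
    by (simp add: uminus_hardy_def Abs_hardy_inverse scaleC_zero_left scaleC_minus1)
  show "hardy_fun (c *\<^sub>C f) = (\<lambda>z. c *\<^sub>C hardy_fun f z)"
    using hardy_set_lincomb[OF hardy_fun[of f] hardy_fun[of f], of c 0]
    by (simp add: scaleC_hardy_def Abs_hardy_inverse scaleC_zero_left)
qed

lemma hardy_eqI: "(\<And>z. hardy_fun f z = hardy_fun g z) \<Longrightarrow> f = g" for f g :: "'a hardy"
  by (metis ext hardy_fun_inject)

lemma hardy_coeff_lincomb: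
  "hardy_coeff (c *\<^sub>C f + d *\<^sub>C g) k = c *\<^sub>C hardy_coeff f k + d *\<^sub>C hardy_coeff g k"
  for f g :: "'a hardy"
proof -
  have "hardy_coeff (c *\<^sub>C f + d *\<^sub>C g) = (\<lambda>k. c *\<^sub>C hardy_coeff f k + d *\<^sub>C hardy_coeff g k)"
    by (intro hardy_coeff_eqI)
       (simp add: hardy_fun_simps hardy_coeffs_lincomb[OF hardy_coeffs_coeff hardy_coeffs_coeff])
  then show ?thesis by simp
qed

lemma hardy_coeff_zero: "hardy_coeff (0::'a hardy) = (\<lambda>_. 0)"
  by (intro hardy_coeff_eqI) (simp add: hardy_fun_simps hardy_coeffs_zero)

instance
proof
  fix f g h :: "'a hardy" and c d :: complex and r s :: real
  show "f + g + h = f + (g + h)" "f + g = g + f" "0 + f = f" "- f + f = 0" "f - g = f + - g"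
    by (rule hardy_eqI; simp add: hardy_fun_simps)+
  show C1: "c *\<^sub>C (f + g) = c *\<^sub>C f + c *\<^sub>C g"
    by (rule hardy_eqI) (simp add: hardy_fun_simps scaleC_add_right)
  show C2: "(c + d) *\<^sub>C f = c *\<^sub>C f + d *\<^sub>C f"
    by (rule hardy_eqI) (simp add: hardy_fun_simps scaleC_add_left)
  show C3: "c *\<^sub>C d *\<^sub>C f = (c * d) *\<^sub>C f"
    by (rule hardy_eqI) (simp add: hardy_fun_simps scaleC_scaleC)
  show C4: "1 *\<^sub>C f = f"
    by (rule hardy_eqI) (simp add: hardy_fun_simps scaleC_one)
  show "r *\<^sub>R f = complex_of_real r *\<^sub>C f" by (rule scaleR_hardy_def)
  show "r *\<^sub>R (f + g) = r *\<^sub>R f + r *\<^sub>R g" "(r + s) *\<^sub>R f = r *\<^sub>R f + s *\<^sub>R f"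
    "r *\<^sub>R s *\<^sub>R f = (r * s) *\<^sub>R f" "1 *\<^sub>R f = f"
    by (rule hardy_eqI; simp add: hardy_fun_simps scaleR_hardy_def scaleC_add_right scaleC_add_left
        scaleC_scaleC scaleC_one)+
  show "dist f g = norm (f - g)" by (rule dist_hardy_def)
  show "sgn f = inverse (norm f) *\<^sub>R f" by (rule sgn_hardy_def)
  show "uniformity = (INF e\<in>{0 <..}. principal {(x, y :: 'a hardy). dist x y < e})"
    by (rule uniformity_hardy_def)
  show "open U \<longleftrightarrow> (\<forall>x\<in>U. eventually (\<lambda>(x', y). x' = x \<longrightarrow> y \<in> U) uniformity)"
    for U :: "'a hardy set" by (rule open_hardy_def)
  show "norm f = sqrt (inner f f)" by (rule norm_hardy_def)
  show IR: "inner f g = Re (cinner f g)" by (rule inner_hardy_def)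
  have sm: "summable (\<lambda>k. cinner (hardy_coeff f k) (hardy_coeff g k))" for f g :: "'a hardy"
    by (intro summable_cinner hardy_coeff_summable)
  show cc: "cinner f g = cnj (cinner g f)" for f g :: "'a hardy"
  proof -
    have "cinner f g = (\<Sum>k. cnj (cinner (hardy_coeff g k) (hardy_coeff f k)))"
      unfolding cinner_hardy_def by (subst cinner_commute) (rule refl)
    also have "\<dots> = cnj (cinner g f)"
      unfolding cinner_hardy_def
      by (rule bounded_linear.suminf[OF bounded_linear_cnj sm, symmetric])
    finally show ?thesis .
  qed
  have lin: "cinner (c *\<^sub>C f + d *\<^sub>C g) h = c * cinner f h + d * cinner g h" for c d and f g h :: "'a hardy"
    unfolding cinner_hardy_def hardy_coeff_lincomb cinner_add_left cinner_scaleC_left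
    by (simp add: suminf_add[symmetric] suminf_mult sm summable_mult)
  show ca: "cinner (f + g) h = cinner f h + cinner g h" for f g h :: "'a hardy"
  proof -
    have "1 *\<^sub>C f + 1 *\<^sub>C g = f + g" by (rule hardy_eqI) (simp add: hardy_fun_simps scaleC_one)
    with lin[of 1 f 1 g h] show ?thesis by simp
  qed
  show cs: "cinner (c *\<^sub>C f) g = c * cinner f g" for c and f g :: "'a hardy"
  proof -
    have "c *\<^sub>C f + 0 *\<^sub>C f = c *\<^sub>C f" by (rule hardy_eqI) (simp add: hardy_fun_simps scaleC_zero_left)
    with lin[of c f 0 f g] show ?thesis by simp
  qed
  show "inner f g = inner g f" using cc[of f g] by (simp add: inner_hardy_def)
  show "inner (f + g) h = inner f h + inner g h" by (simp add: inner_hardy_def ca)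
  show "inner (r *\<^sub>R f) g = r * inner f g" by (simp add: inner_hardy_def scaleR_hardy_def cs)
  have sq: "inner f f = (\<Sum>k. (norm (hardy_coeff f k))\<^sup>2)" for f :: "'a hardy"
    unfolding inner_hardy_def cinner_hardy_def
    by (subst bounded_linear.suminf[OF bounded_linear_Re sm]) (simp add: cinner_self)
  show "0 \<le> inner f f" unfolding sq by (intro suminf_nonneg hardy_coeff_summable) simp
  show "inner f f = 0 \<longleftrightarrow> f = 0"
  proof
    assume "inner f f = 0"
    then have "(norm (hardy_coeff f k))\<^sup>2 = 0" for k
      unfolding sq using suminf_eq_zero_iff[OF hardy_coeff_summable[of f]] by simp
    then have "hardy_coeff f = hardy_coeff 0" by (auto simp: hardy_coeff_zero)
    then show "f = 0" by (rule hardy_coeff_inject)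
  qed (simp add: sq hardy_coeff_zero)
qed

end

lemma hardy_coeff_diff: "hardy_coeff (f - g) k = hardy_coeff f k - hardy_coeff g k"
  using hardy_coeff_lincomb[of 1 f "-1" g k] by (simp add: scaleC_one scaleC_minus1)

lemma norm_hardy_eq: "(norm f)\<^sup>2 = (\<Sum>k. (norm (hardy_coeff f k))\<^sup>2)"
proof -
  have "complex_of_real ((norm f)\<^sup>2) = (\<Sum>k. complex_of_real ((norm (hardy_coeff f k))\<^sup>2))"
    unfolding cinner_self[symmetric] by (rule cinner_hardy_def)
  then show ?thesis
    by (simp only: bounded_linear.suminf[OF bounded_linear_of_real hardy_coeff_summable, symmetric]
        of_real_eq_iff)
qed

instance hardy :: (chilbert_space) chilbert_space
proof
  fix X :: "nat \<Rightarrow> 'a hardy"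
  assume X: "Cauchy X"
  define A where "A n = hardy_coeff (X n)" for n
  have part: "(\<Sum>k<K. (norm (hardy_coeff f k))\<^sup>2) \<le> (norm f)\<^sup>2" for f :: "'a hardy" and K
    unfolding norm_hardy_eq by (intro sum_le_suminf hardy_coeff_summable) auto
  have le: "norm (hardy_coeff f k) \<le> norm f" for f :: "'a hardy" and k
  proof -
    have "(norm (hardy_coeff f k))\<^sup>2 \<le> (\<Sum>j<Suc k. (norm (hardy_coeff f j))\<^sup>2)"
      by (simp add: sum_nonneg)
    also have "\<dots> \<le> (norm f)\<^sup>2" by (rule part)
    finally show ?thesis by (simp add: power2_le_iff_abs_le)
  qed
  have "Cauchy (\<lambda>n. A n k)" for k
  proof (rule metric_CauchyI)
    fix e :: real assume "e > 0"
    then obtain M where M: "\<And>m n. m \<ge> M \<Longrightarrow> n \<ge> M \<Longrightarrow> dist (X m) (X n) < e"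
      using metric_CauchyD[OF X] by metis
    have "dist (A m k) (A n k) < e" if "m \<ge> M" "n \<ge> M" for m n
      using M[OF that] le[where f = "X m - X n" and k = k] by (simp add: dist_norm A_def hardy_coeff_diff)
    then show "\<exists>M. \<forall>m\<ge>M. \<forall>n\<ge>M. dist (A m k) (A n k) < e" by blast
  qed
  then have "\<forall>k. \<exists>l. (\<lambda>n. A n k) \<longlonglongrightarrow> l"
    by (meson Cauchy_convergent convergent_def)
  then obtain a where a: "\<And>k. (\<lambda>n. A n k) \<longlonglongrightarrow> a k" by metis
  have bnd: "\<exists>M. \<forall>n\<ge>M. \<forall>K. (\<Sum>k<K. (norm (A n k - a k))\<^sup>2) \<le> e\<^sup>2" if "e > 0" for e :: real
  proof -
    obtain M where M: "\<And>m n. m \<ge> M \<Longrightarrow> n \<ge> M \<Longrightarrow> dist (X m) (X n) < e"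
      using metric_CauchyD[OF X \<open>e > 0\<close>] by metis
    have "(\<Sum>k<K. (norm (A n k - a k))\<^sup>2) \<le> e\<^sup>2" if n: "n \<ge> M" for n K
    proof (rule tendsto_upperbound)
      show "(\<lambda>m. \<Sum>k<K. (norm (A n k - A m k))\<^sup>2) \<longlonglongrightarrow> (\<Sum>k<K. (norm (A n k - a k))\<^sup>2)"
        by (intro tendsto_intros a)
      have "(\<Sum>k<K. (norm (A n k - A m k))\<^sup>2) \<le> e\<^sup>2" if "m \<ge> M" for m
      proof -
        have "(\<Sum>k<K. (norm (A n k - A m k))\<^sup>2) \<le> (norm (X n - X m))\<^sup>2"
          using part[where K = K and f = "X n - X m"] by (simp add: A_def hardy_coeff_diff)
        also have "\<dots> \<le> e\<^sup>2"
          using M[OF n that] by (intro power_mono) (simp_all add: dist_norm)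
        finally show ?thesis .
      qed
      then show "eventually (\<lambda>m. (\<Sum>k<K. (norm (A n k - A m k))\<^sup>2) \<le> e\<^sup>2) sequentially"
        by (auto simp: eventually_sequentially)
    qed simp
    then show ?thesis by blast
  qed
  have sqs: "summable (\<lambda>k. (norm (a k))\<^sup>2)"
  proof -
    obtain M where "\<And>K. (\<Sum>k<K. (norm (A M k - a k))\<^sup>2) \<le> 1\<^sup>2"
      using bnd[of 1] by auto
    then have "summable (\<lambda>k. (norm (A M k - a k))\<^sup>2)"
      by (intro summableI_nonneg_bounded[where x = 1]) auto
    from square_summable_lincomb[OF hardy_coeff_summable[of "X M"] this, of 1 "-1"]
    show ?thesis by (simp add: A_def scaleC_one scaleC_minus1)
  qed
  then obtain f where f: "hardy_coeff f = a" using hardy_coeff_surj by blast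
  have "X \<longlonglongrightarrow> f"
  proof (rule metric_LIMSEQ_I)
    fix e :: real assume e: "e > 0"
    then obtain M where M: "\<And>n K. n \<ge> M \<Longrightarrow> (\<Sum>k<K. (norm (A n k - a k))\<^sup>2) \<le> (e/2)\<^sup>2"
      using bnd[of "e/2"] by auto
    have "dist (X n) f < e" if "n \<ge> M" for n
    proof -
      have "(norm (X n - f))\<^sup>2 \<le> (e/2)\<^sup>2"
        unfolding norm_hardy_eq using M[OF that]
        by (intro suminf_le_const hardy_coeff_summable) (simp add: hardy_coeff_diff f A_def)
      then have "norm (X n - f) \<le> e/2" using e by (simp add: power2_le_iff_abs_le)
      then show ?thesis using e by (simp add: dist_norm)
    qed
    then show "\<exists>M. \<forall>n\<ge>M. dist (X n) f < e" by blast
  qed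
  then show "convergent X" by (auto simp: convergent_def)
qed


section \<open>Multiplication operators and BCL tuples\<close>

text \<open>
  Bounded analytic functions on the disc with values in \<open>\<B>(\<E>)\<close>: analyticity is complex
  differentiability with respect to the operator norm.  Values outside the disc are irrelevant.
\<close>

definition bounded_analytic_op :: "(complex \<Rightarrow> 'e::complex_inner \<Rightarrow> 'e) \<Rightarrow> bool" where
  "bounded_analytic_op \<Phi> \<longleftrightarrow>
     (\<forall>z\<in>ball 0 1. bounded_clinear (\<Phi> z)) \<and>
     (\<exists>C. \<forall>z\<in>ball 0 1. onorm (\<Phi> z) \<le> C) \<and>
     (\<forall>z\<in>ball 0 1. \<exists>D. bounded_clinear D \<and>
        ((\<lambda>w. onorm (\<lambda>x. inverse (w - z) *\<^sub>C (\<Phi> w x - \<Phi> z x) - D x)) \<longlongrightarrow> 0) (at z))"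

definition mult_op :: "(complex \<Rightarrow> 'e::chilbert_space \<Rightarrow> 'e) \<Rightarrow> 'e hardy \<Rightarrow> 'e hardy" where
  "mult_op \<Phi> f = (THE g. \<forall>z\<in>ball 0 1. hardy_fun g z = \<Phi> z (hardy_fun f z))"

definition hardy_shift :: "'e::chilbert_space hardy \<Rightarrow> 'e hardy" where
  "hardy_shift = mult_op (\<lambda>z x. z *\<^sub>C x)"

definition bcl_tuple :: "nat \<Rightarrow> (nat \<Rightarrow> complex \<Rightarrow> 'e::chilbert_space \<Rightarrow> 'e) \<Rightarrow> bool" where
  "bcl_tuple n \<Phi> \<longleftrightarrow>
     (\<forall>i\<in>{1..n}. bounded_analytic_op (\<Phi> i) \<and> linear_isometry (mult_op (\<Phi> i))) \<and>
     commuting_tuple n (\<lambda>i. mult_op (\<Phi> i)) \<and>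
     tuple_prod n (\<lambda>i. mult_op (\<Phi> i)) = hardy_shift"

text \<open>
  The tuple \<open>V\<close> dilates \<open>T\<close> isometrically with dilation map \<open>\<pi>\<close>.
\<close>

definition isometric_dilation ::
  "nat \<Rightarrow> (nat \<Rightarrow> 'h::complex_inner \<Rightarrow> 'h) \<Rightarrow> (nat \<Rightarrow> 'k::complex_inner \<Rightarrow> 'k) \<Rightarrow> ('h \<Rightarrow> 'k) \<Rightarrow> bool"
where
  "isometric_dilation n T V \<pi> \<longleftrightarrow>
     (\<forall>i\<in>{1..n}. linear_isometry (V i)) \<and> commuting_tuple n V \<and> linear_isometry \<pi> \<and>
     (\<forall>i\<in>{1..n}. \<pi> \<circ> cadjoint (T i) = cadjoint (V i) \<circ> \<pi>)"

end

theory Submission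
  imports Defs
begin

text \<open>
  For commuting isometries \<open>V\<^sub>i\<close> in the class, the vanishing defects say that \<open>V\<^sub>j\<close> restricts to a
  unitary on the wandering subspace of \<open>V\<^sub>i\<close> for \<open>j \<noteq> i\<close>. With purity of the product, the space is
  the orthogonal sum of the shift parts \<open>ran P\<^sub>i\<close> of the \<open>V\<^sub>i\<close>, each reducing all \<open>V\<^sub>j\<close>. Since \<open>P\<^sub>i\<close> is the strong
  limit of \<open>U\<^sup>k U\<^sup>*\<^sup>k\<close> for \<open>U\<close> the product of the \<open>V\<^sub>j\<close> with \<open>j \<noteq> i\<close>, the map \<open>P\<^sub>i \<pi> h \<mapsto> P\<^sub>i \<pi> X\<^sup>* h\<close>
  has norm at most \<open>\<parallel>X\<parallel>\<close>. On \<open>ran P\<^sub>i\<close> it extends along the unitaries \<open>V\<^sub>j\<close>, and then to an operator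
  commuting with \<open>V\<^sub>i\<^sup>*\<close> by one-step extensions from \<open>N\<close> to \<open>N + V\<^sub>i N\<close>. Each step is canonical (an
  orthogonal projection for a semi-inner product), so it preserves commutation with the unitaries
  and with scalars; thus complex linearity comes for free in the real setting.
  The orthogonal sum of these operators is the adjoint of the lift.
\<close>

section \<open>Semi-inner products\<close>

lemma discriminant_le:
  fixes a b c :: real
  assumes "\<And>t. 0 \<le> a + 2 * t * b + t\<^sup>2 * c"
  shows "b\<^sup>2 \<le> a * c"
proof (cases "c = 0")
  case True
  have "b = 0"
  proof (rule ccontr)
    assume b: "b \<noteq> 0"
    have "0 \<le> a + 2 * (- (a + 1) / (2 * b)) * b"
      using assms[of "- (a + 1) / (2 * b)"] True by simp
    then show False using b by (simp add: field_simps)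
  qed
  then show ?thesis using True by simp
next
  case False
  have a: "0 \<le> a" using assms[of 0] by simp
  have c: "0 < c"
  proof (rule ccontr)
    assume "\<not> 0 < c"
    then have c: "c < 0" using False by simp
    define u where "u = a / (- c)"
    define t where "t = (if b \<le> 0 then 1 + u else - (1 + u))"
    have u: "0 \<le> u" using a c unfolding u_def by (intro divide_nonneg_pos) auto
    have "t * b \<le> 0"
      using u by (auto simp: t_def mult_nonneg_nonpos mult_nonpos_nonneg)
    moreover have "t\<^sup>2 = (1 + u)\<^sup>2" unfolding t_def by (simp add: power2_eq_square algebra_simps)
    then have "1 + u \<le> t\<^sup>2"
      using u by (simp add: power2_eq_square algebra_simps)
    then have "t\<^sup>2 * c \<le> (1 + u) * c"
      using c by (intro mult_right_mono_neg) auto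
    moreover have "(1 + u) * c = c - a" using c by (simp add: u_def field_simps)
    ultimately show False using assms[of t] c by (simp add: mult.assoc)
  qed
  have "0 \<le> a + 2 * (- b / c) * b + (- b / c)\<^sup>2 * c" by (rule assms)
  also have "\<dots> = a - b\<^sup>2 / c" using c by (simp add: field_simps power2_eq_square)
  finally show ?thesis using c by (simp add: field_simps)
qed

locale semi_inner =
  fixes M :: "'a::real_vector set" and B :: "'a \<Rightarrow> 'a \<Rightarrow> real"
  assumes subspace_M: "subspace M"
    and B_sym: "x \<in> M \<Longrightarrow> y \<in> M \<Longrightarrow> B x y = B y x"
    and B_add: "x \<in> M \<Longrightarrow> y \<in> M \<Longrightarrow> z \<in> M \<Longrightarrow> B (x + y) z = B x z + B y z"
    and B_scale: "x \<in> M \<Longrightarrow> y \<in> M \<Longrightarrow> B (r *\<^sub>R x) y = r * B x y"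
    and B_nonneg: "x \<in> M \<Longrightarrow> 0 \<le> B x x"
begin

lemma M_add: "x \<in> M \<Longrightarrow> y \<in> M \<Longrightarrow> x + y \<in> M"
  and M_scale: "x \<in> M \<Longrightarrow> r *\<^sub>R x \<in> M"
  and M_diff: "x \<in> M \<Longrightarrow> y \<in> M \<Longrightarrow> x - y \<in> M"
  and M_zero: "0 \<in> M"
  using subspace_M by (auto simp: subspace_add subspace_scale subspace_diff subspace_0)

lemma B_diff: "x \<in> M \<Longrightarrow> y \<in> M \<Longrightarrow> z \<in> M \<Longrightarrow> B (x - y) z = B x z - B y z"
  using B_add[of x "(-1) *\<^sub>R y" z] B_scale[of y z "-1"] M_scale[of y "-1"] by simp

lemma B_add_right: "x \<in> M \<Longrightarrow> y \<in> M \<Longrightarrow> z \<in> M \<Longrightarrow> B z (x + y) = B z x + B z y"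
  by (simp add: B_sym[of z] B_add M_add)

lemma B_scale_right: "x \<in> M \<Longrightarrow> y \<in> M \<Longrightarrow> B y (r *\<^sub>R x) = r * B y x"
  by (simp add: B_sym[of y] B_scale M_scale)

lemma B_perturb:
  assumes "x \<in> M" "y \<in> M"
  shows "B (x + t *\<^sub>R y) (x + t *\<^sub>R y) = B x x + 2 * t * B x y + t\<^sup>2 * B y y"
  using assms B_sym[OF assms]
  by (simp add: B_add B_add_right B_scale B_scale_right M_add M_scale power2_eq_square algebra_simps)

lemma B_Cauchy_Schwarz:
  assumes "x \<in> M" "y \<in> M"
  shows "(B x y)\<^sup>2 \<le> B x x * B y y"
  by (rule discriminant_le)
     (use B_nonneg[OF M_add[OF assms(1) M_scale[OF assms(2)]]] in \<open>simp add: B_perturb[OF assms]\<close>)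

lemma semi_inner_subset: "subspace N \<Longrightarrow> N \<subseteq> M \<Longrightarrow> semi_inner N B"
  by unfold_locales (auto simp: B_sym B_add B_scale B_nonneg subset_iff)

lemma approximate_Riesz:
  assumes add: "\<And>x y. x \<in> M \<Longrightarrow> y \<in> M \<Longrightarrow> \<phi> (x + y) = \<phi> x + \<phi> y"
    and scale: "\<And>r x. x \<in> M \<Longrightarrow> \<phi> (r *\<^sub>R x) = r * \<phi> x"
    and bound: "\<And>x. x \<in> M \<Longrightarrow> (\<phi> x)\<^sup>2 \<le> C * B x x"
    and e: "0 < (\<epsilon>::real)"
  shows "\<exists>q\<in>M. \<forall>y\<in>M. (\<phi> y - B q y)\<^sup>2 \<le> \<epsilon> * B y y"
proof -
  define f where "f y = B y y - 2 * \<phi> y" for y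
  have lower: "- \<bar>C\<bar> \<le> f y" if y: "y \<in> M" for y
  proof -
    have "(2 * \<phi> y)\<^sup>2 \<le> 4 * (\<bar>C\<bar> * B y y)"
      using bound[OF y] mult_right_mono[OF abs_ge_self[of C] B_nonneg[OF y]] by (simp add: power_mult_distrib)
    also have "\<dots> \<le> (\<bar>C\<bar> + B y y)\<^sup>2"
      using zero_le_power2[of "\<bar>C\<bar> - B y y"] by (simp add: power2_eq_square algebra_simps)
    finally have "2 * \<phi> y \<le> \<bar>C\<bar> + B y y"
      by (rule power2_le_imp_le) (use B_nonneg[OF y] in auto)
    then show ?thesis by (simp add: f_def)
  qed
  define d where "d = (INF y\<in>M. f y)"
  have bdd: "bdd_below (f ` M)" using lower by (auto simp: bdd_below_def)
  have "\<exists>q\<in>M. f q < d + \<epsilon>"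
    using cINF_less_iff[of M f "d + \<epsilon>"] bdd M_zero e unfolding d_def by auto
  then obtain q where q: "q \<in> M" "f q < d + \<epsilon>" by blast
  have "(B q y - \<phi> y)\<^sup>2 \<le> \<epsilon> * B y y" if y: "y \<in> M" for y
  proof (rule discriminant_le)
    fix t :: real
    have "d \<le> f (q + t *\<^sub>R y)"
      unfolding d_def using bdd q y by (intro cINF_lower) (auto intro: M_add M_scale)
    also have "f (q + t *\<^sub>R y) = f q + 2 * t * (B q y - \<phi> y) + t\<^sup>2 * B y y"
      using q y by (simp add: f_def B_perturb add scale M_scale algebra_simps)
    finally show "0 \<le> \<epsilon> + 2 * t * (B q y - \<phi> y) + t\<^sup>2 * B y y" using q by simp
  qed
  then show ?thesis using q by (metis power2_commute)
qed

end

lemma semi_inner_inner: "semi_inner UNIV (inner :: 'a::real_inner \<Rightarrow> 'a \<Rightarrow> real)"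
  by unfold_locales (auto simp: inner_add_left intro: inner_commute)

lemma Riesz_representation:
  fixes \<phi> :: "'a::{real_inner, complete_space} \<Rightarrow> real"
  assumes "bounded_linear \<phi>"
  shows "\<exists>q. \<forall>y. \<phi> y = inner q y"
proof -
  interpret \<phi>: bounded_linear \<phi> by fact
  interpret semi_inner UNIV "inner :: 'a \<Rightarrow> 'a \<Rightarrow> real" by (rule semi_inner_inner)
  obtain C where C: "\<And>x. norm (\<phi> x) \<le> norm x * C" using \<phi>.bounded by blast
  have bound: "(\<phi> x)\<^sup>2 \<le> C\<^sup>2 * inner x x" for x
    using power_mono[OF C[of x], of 2] by (simp add: power_mult_distrib power2_norm_eq_inner mult.commute)
  have "\<exists>q. \<forall>y. (\<phi> y - inner q y)\<^sup>2 \<le> (inverse (real (Suc k)))\<^sup>2 * inner y y" for k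
    using approximate_Riesz[of \<phi> "C\<^sup>2" "(inverse (real (Suc k)))\<^sup>2"] \<phi>.add \<phi>.scaleR bound by auto
  then obtain q where q: "\<And>k y. (\<phi> y - inner (q k) y)\<^sup>2 \<le> (inverse (real (Suc k)))\<^sup>2 * inner y y"
    by metis
  have q': "\<bar>\<phi> y - inner (q k) y\<bar> \<le> inverse (real (Suc k)) * norm y" for k y
    using q[of y k] by (simp add: power2_norm_eq_inner[symmetric] power_mult_distrib[symmetric] abs_le_square_iff[symmetric])
  have close: "norm (q k - q m) \<le> inverse (real (Suc k)) + inverse (real (Suc m))" for k m
  proof -
    let ?d = "q k - q m"
    have "norm ?d * norm ?d = (\<phi> ?d - inner (q m) ?d) - (\<phi> ?d - inner (q k) ?d)"
      using inner_diff_left[of "q k" "q m" ?d] by (simp only: power2_norm_eq_inner power2_eq_square[symmetric])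
    also have "\<dots> \<le> inverse (real (Suc k)) * norm ?d + inverse (real (Suc m)) * norm ?d"
      using q'[of ?d k] q'[of ?d m] unfolding abs_le_iff by linarith
    also have "\<dots> = (inverse (real (Suc k)) + inverse (real (Suc m))) * norm ?d"
      by (rule distrib_right[symmetric])
    finally have le: "norm ?d * norm ?d \<le> (inverse (real (Suc k)) + inverse (real (Suc m))) * norm ?d" .
    show ?thesis
    proof (cases "norm ?d = 0")
      case True
      then show ?thesis by (simp only:) simp
    next
      case False
      then have "0 < norm ?d" by simp
      with le show ?thesis by (rule mult_right_le_imp_le)
    qed
  qed
  have "Cauchy q"
  proof (rule metric_CauchyI)
    fix \<epsilon> :: real assume "0 < \<epsilon>"
    then obtain N where N: "inverse (real (Suc N)) < \<epsilon> / 2"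
      using reals_Archimedean[of "\<epsilon> / 2"] by auto
    have "dist (q k) (q m) < \<epsilon>" if "k \<ge> N" "m \<ge> N" for k m
    proof -
      have "inverse (real (Suc k)) \<le> inverse (real (Suc N))" "inverse (real (Suc m)) \<le> inverse (real (Suc N))"
        using that by (auto intro!: le_imp_inverse_le)
      with close[of k m] N show ?thesis unfolding dist_norm by linarith
    qed
    then show "\<exists>N. \<forall>k\<ge>N. \<forall>m\<ge>N. dist (q k) (q m) < \<epsilon>" by blast
  qed
  then obtain l where l: "q \<longlonglongrightarrow> l" using Cauchy_convergent convergent_def by blast
  have "\<phi> y = inner l y" for y
  proof -
    have "(\<lambda>k. inverse (real (Suc k)) * norm y) \<longlonglongrightarrow> 0 * norm y"
      by (intro tendsto_mult LIMSEQ_inverse_real_of_nat tendsto_const)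
    then have g: "(\<lambda>k. inverse (real (Suc k)) * norm y) \<longlonglongrightarrow> 0" by simp
    have "(\<lambda>k. \<phi> y - inner (q k) y) \<longlonglongrightarrow> 0"
      by (rule Lim_null_comparison[OF _ g]) (use q' in \<open>auto simp del: of_nat_Suc\<close>)
    moreover have "(\<lambda>k. \<phi> y - inner (q k) y) \<longlonglongrightarrow> \<phi> y - inner l y"
      by (intro tendsto_intros l)
    ultimately show ?thesis using LIMSEQ_unique by fastforce
  qed
  then show ?thesis by blast
qed

definition linear_map_on :: "'a::real_vector set \<Rightarrow> ('a \<Rightarrow> 'b::real_vector) \<Rightarrow> bool" where
  "linear_map_on N f \<longleftrightarrow>
     (\<forall>x\<in>N. \<forall>y\<in>N. f (x + y) = f x + f y) \<and> (\<forall>r. \<forall>x\<in>N. f (r *\<^sub>R x) = r *\<^sub>R f x)"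

lemma linear_map_on_add: "linear_map_on N f \<Longrightarrow> x \<in> N \<Longrightarrow> y \<in> N \<Longrightarrow> f (x + y) = f x + f y"
  and linear_map_on_scale: "linear_map_on N f \<Longrightarrow> x \<in> N \<Longrightarrow> f (r *\<^sub>R x) = r *\<^sub>R f x"
  by (auto simp: linear_map_on_def)

lemma linear_map_on_diff:
  assumes "subspace N" "linear_map_on N f" "x \<in> N" "y \<in> N"
  shows "f (x - y) = f x - f y"
proof -
  have "f (x + (-1) *\<^sub>R y) = f x + (-1) *\<^sub>R f y"
    using assms by (metis linear_map_on_add linear_map_on_scale subspace_scale)
  then show ?thesis by simp
qed

lemma square_diff_le: "u\<^sup>2 \<le> a \<Longrightarrow> v\<^sup>2 \<le> b \<Longrightarrow> (u - v)\<^sup>2 \<le> 2 * (a + b)" for u v a b :: real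
  using zero_le_power2[of "u + v"] by (simp add: power2_eq_square algebra_simps)

context semi_inner
begin

context
  fixes N :: "'a set" and e :: "'a \<Rightarrow> 'w::{real_normed_vector, complete_space}"
  assumes subspace_N: "subspace N" and NM: "N \<subseteq> M"
    and lin_e: "linear_map_on N e"
    and bound_e: "\<And>x. x \<in> N \<Longrightarrow> (norm (e x))\<^sup>2 \<le> B x x"
begin

text \<open>\<open>q\<close> approximates the \<open>B\<close>-orthogonal projection of \<open>x\<close> to \<open>N\<close>, which itself need not exist.\<close>

definition near_proj :: "'a \<Rightarrow> 'a \<Rightarrow> real \<Rightarrow> bool" where
  "near_proj x q \<epsilon> \<longleftrightarrow> q \<in> N \<and> (\<forall>y\<in>N. (B (x - q) y)\<^sup>2 \<le> \<epsilon> * B y y)"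

definition proj_value :: "'a \<Rightarrow> 'w \<Rightarrow> bool" where
  "proj_value x w \<longleftrightarrow> (\<exists>q \<epsilon>. (\<forall>k. near_proj x (q k) (\<epsilon> k)) \<and> \<epsilon> \<longlonglongrightarrow> 0 \<and> (\<lambda>k. e (q k)) \<longlonglongrightarrow> w)"

lemma proj_valueI:
  "(\<And>k. near_proj x (q k) (\<epsilon> k)) \<Longrightarrow> \<epsilon> \<longlonglongrightarrow> 0 \<Longrightarrow> (\<lambda>k. e (q k)) \<longlonglongrightarrow> w \<Longrightarrow> proj_value x w"
  unfolding proj_value_def by (intro exI[of _ q] exI[of _ \<epsilon>]) auto

lemma near_proj_close:
  assumes x: "x \<in> M" and q: "near_proj x q \<epsilon>" "near_proj x q' \<epsilon>'" and \<epsilon>: "0 \<le> \<epsilon> + \<epsilon>'"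
  shows "(norm (e q - e q'))\<^sup>2 \<le> 2 * (\<epsilon> + \<epsilon>')"
proof -
  let ?d = "q - q'"
  have N: "q \<in> N" "q' \<in> N" using q by (auto simp: near_proj_def)
  then have d: "?d \<in> N" by (rule subspace_diff[OF subspace_N])
  have M: "q \<in> M" "q' \<in> M" "?d \<in> M" using N d NM by auto
  have "B ?d ?d = B (x - q') ?d - B (x - q) ?d"
    using M x by (simp add: B_diff M_diff)
  moreover have "(B (x - q') ?d - B (x - q) ?d)\<^sup>2 \<le> 2 * (\<epsilon>' * B ?d ?d + \<epsilon> * B ?d ?d)"
    by (rule square_diff_le) (use q d in \<open>auto simp only: near_proj_def\<close>)
  ultimately have "(B ?d ?d)\<^sup>2 \<le> 2 * (\<epsilon>' * B ?d ?d + \<epsilon> * B ?d ?d)" by (simp only:)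
  then have *: "B ?d ?d * B ?d ?d \<le> 2 * (\<epsilon> + \<epsilon>') * B ?d ?d"
    by (simp add: power2_eq_square algebra_simps)
  have "B ?d ?d \<le> 2 * (\<epsilon> + \<epsilon>')"
  proof (cases "B ?d ?d = 0")
    case False
    then have "0 < B ?d ?d" using B_nonneg[OF M(3)] by simp
    with * show ?thesis by (rule mult_right_le_imp_le)
  qed (use \<epsilon> in simp)
  then show ?thesis
    using bound_e[OF d] by (simp add: linear_map_on_diff[OF subspace_N lin_e N])
qed

lemma near_proj_nonneg_eps: "near_proj x q \<epsilon> \<Longrightarrow> near_proj x q \<bar>\<epsilon>\<bar>"
  unfolding near_proj_def using NM B_nonneg
  by (metis abs_ge_self mult_right_mono order_trans subsetD)

lemma proj_value_unique:
  assumes x: "x \<in> M" and "proj_value x w" "proj_value x w'"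
  shows "w = w'"
proof -
  obtain q \<epsilon> where q: "\<And>k. near_proj x (q k) (\<epsilon> k)" "\<epsilon> \<longlonglongrightarrow> 0" "(\<lambda>k. e (q k)) \<longlonglongrightarrow> w"
    using assms(2) unfolding proj_value_def by blast
  obtain q' \<epsilon>' where q': "\<And>k. near_proj x (q' k) (\<epsilon>' k)" "\<epsilon>' \<longlonglongrightarrow> 0" "(\<lambda>k. e (q' k)) \<longlonglongrightarrow> w'"
    using assms(3) unfolding proj_value_def by blast
  have le: "(norm (e (q k) - e (q' k)))\<^sup>2 \<le> 2 * (\<bar>\<epsilon> k\<bar> + \<bar>\<epsilon>' k\<bar>)" for k
    using near_proj_close[OF x near_proj_nonneg_eps[OF q(1)[of k]] near_proj_nonneg_eps[OF q'(1)[of k]]]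
    by simp
  have "(\<lambda>k. 2 * (\<bar>\<epsilon> k\<bar> + \<bar>\<epsilon>' k\<bar>)) \<longlonglongrightarrow> 2 * (\<bar>0\<bar> + \<bar>0\<bar>)"
    by (intro tendsto_intros q q')
  moreover have "(\<lambda>k. (norm (e (q k) - e (q' k)))\<^sup>2) \<longlonglongrightarrow> (norm (w - w'))\<^sup>2"
    by (intro tendsto_intros q q')
  ultimately have "(norm (w - w'))\<^sup>2 \<le> 2 * (\<bar>0\<bar> + \<bar>0\<bar>)"
    using le by (intro LIMSEQ_le[of _ "(norm (w - w'))\<^sup>2"]) auto
  then show ?thesis by simp
qed

lemma proj_value_exists:
  assumes x: "x \<in> M"
  shows "\<exists>w. proj_value x w"
proof -
  interpret N: semi_inner N B using semi_inner_subset[OF subspace_N NM] .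
  have xN: "y \<in> M" if "y \<in> N" for y using that NM by auto
  have "\<exists>q. near_proj x q (inverse (real (Suc k)))" for k
  proof -
    have "\<exists>q\<in>N. \<forall>y\<in>N. (B x y - B q y)\<^sup>2 \<le> inverse (real (Suc k)) * B y y"
      by (rule N.approximate_Riesz[where C = "B x x"])
         (use x xN in \<open>auto simp: B_add_right B_scale_right B_Cauchy_Schwarz\<close>)
    then show ?thesis unfolding near_proj_def using B_diff x xN by metis
  qed
  then obtain q where q: "\<And>k. near_proj x (q k) (inverse (real (Suc k)))" by metis
  have "Cauchy (\<lambda>k. e (q k))"
  proof (rule metric_CauchyI)
    fix \<epsilon> :: real assume \<epsilon>: "0 < \<epsilon>"
    then obtain K where K: "inverse (real (Suc K)) < \<epsilon>\<^sup>2 / 4"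
      using reals_Archimedean[of "\<epsilon>\<^sup>2 / 4"] by auto
    have "dist (e (q k)) (e (q m)) < \<epsilon>" if "k \<ge> K" "m \<ge> K" for k m
    proof -
      have "inverse (real (Suc k)) \<le> inverse (real (Suc K))" "inverse (real (Suc m)) \<le> inverse (real (Suc K))"
        using that by (auto intro!: le_imp_inverse_le)
      moreover have "(norm (e (q k) - e (q m)))\<^sup>2 \<le> 2 * (inverse (real (Suc k)) + inverse (real (Suc m)))"
        by (rule near_proj_close[OF x q q]) simp
      ultimately have "(norm (e (q k) - e (q m)))\<^sup>2 < 4 * (\<epsilon>\<^sup>2 / 4)"
        using K by (smt (verit))
      then have "(norm (e (q k) - e (q m)))\<^sup>2 < \<epsilon>\<^sup>2" by simp
      then show ?thesis using \<epsilon> unfolding dist_norm by (meson less_imp_le power_less_imp_less_base)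
    qed
    then show "\<exists>K. \<forall>k\<ge>K. \<forall>m\<ge>K. dist (e (q k)) (e (q m)) < \<epsilon>" by blast
  qed
  then obtain w where "(\<lambda>k. e (q k)) \<longlonglongrightarrow> w" using Cauchy_convergent convergent_def by blast
  with proj_valueI[OF q LIMSEQ_inverse_real_of_nat] show ?thesis by blast
qed

lemma proj_value_self: "x \<in> N \<Longrightarrow> proj_value x (e x)"
  unfolding proj_value_def near_proj_def
  by (rule exI[of _ "\<lambda>_. x"], rule exI[of _ "\<lambda>_. 0"])
     (use NM B_scale[of x _ 0] in \<open>auto simp: subset_iff\<close>)

lemma proj_value_add:
  assumes M: "x \<in> M" "x' \<in> M" and "proj_value x w" "proj_value x' w'"
  shows "proj_value (x + x') (w + w')"
proof -
  obtain q \<epsilon> where q: "\<And>k. near_proj x (q k) (\<epsilon> k)" "\<epsilon> \<longlonglongrightarrow> 0" "(\<lambda>k. e (q k)) \<longlonglongrightarrow> w"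
    using assms(3) unfolding proj_value_def by blast
  obtain q' \<epsilon>' where q': "\<And>k. near_proj x' (q' k) (\<epsilon>' k)" "\<epsilon>' \<longlonglongrightarrow> 0" "(\<lambda>k. e (q' k)) \<longlonglongrightarrow> w'"
    using assms(4) unfolding proj_value_def by blast
  have N: "q k \<in> N" "q' k \<in> N" for k using q q' by (auto simp: near_proj_def)
  have "near_proj (x + x') (q k + q' k) (2 * (\<epsilon> k + \<epsilon>' k))" for k
    unfolding near_proj_def
  proof (intro conjI ballI)
    show "q k + q' k \<in> N" by (intro subspace_add subspace_N N)
    fix y assume y: "y \<in> N"
    have M': "y \<in> M" "q k \<in> M" "q' k \<in> M" using y N NM by auto
    have "B (x + x' - (q k + q' k)) y = B (x - q k) y - (- B (x' - q' k) y)"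
      using M M' by (simp add: B_diff B_add M_diff M_add)
    also have "(\<dots>)\<^sup>2 \<le> 2 * (\<epsilon> k * B y y + \<epsilon>' k * B y y)"
      using q(1)[of k] q'(1)[of k] y by (intro square_diff_le) (auto simp: near_proj_def)
    finally show "(B (x + x' - (q k + q' k)) y)\<^sup>2 \<le> 2 * (\<epsilon> k + \<epsilon>' k) * B y y"
      by (simp add: algebra_simps)
  qed
  moreover have "(\<lambda>k. 2 * (\<epsilon> k + \<epsilon>' k)) \<longlonglongrightarrow> 2 * (0 + 0)"
    by (intro tendsto_intros q q')
  then have "(\<lambda>k. 2 * (\<epsilon> k + \<epsilon>' k)) \<longlonglongrightarrow> 0" by simp
  moreover have "(\<lambda>k. e (q k + q' k)) \<longlonglongrightarrow> w + w'"
    using tendsto_add[OF q(3) q'(3)] by (simp add: linear_map_on_add[OF lin_e] N)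
  ultimately show ?thesis by (rule proj_valueI)
qed

lemma proj_value_map:
  assumes x: "x \<in> M" "proj_value x w"
    and lin_A: "linear_map_on M A" and AM: "\<And>x. x \<in> M \<Longrightarrow> A x \<in> M" and AN: "\<And>x. x \<in> N \<Longrightarrow> A x \<in> N"
    and A'N: "\<And>x. x \<in> N \<Longrightarrow> A' x \<in> N"
    and adj: "\<And>x y. x \<in> M \<Longrightarrow> y \<in> N \<Longrightarrow> B (A x) y = B x (A' y)"
    and bdd: "\<And>y. y \<in> N \<Longrightarrow> B (A' y) (A' y) \<le> a * B y y"
    and C: "bounded_linear C" and eA: "\<And>x. x \<in> N \<Longrightarrow> e (A x) = C (e x)"
  shows "proj_value (A x) (C w)"
proof -
  obtain q \<epsilon> where q: "\<And>k. near_proj x (q k) (\<epsilon> k)" "\<epsilon> \<longlonglongrightarrow> 0" "(\<lambda>k. e (q k)) \<longlonglongrightarrow> w"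
    using x unfolding proj_value_def by blast
  have N: "q k \<in> N" for k using q by (auto simp: near_proj_def)
  have "near_proj (A x) (A (q k)) (\<bar>\<epsilon> k\<bar> * a)" for k
    unfolding near_proj_def
  proof (intro conjI ballI)
    show "A (q k) \<in> N" using AN N by blast
    fix y assume y: "y \<in> N"
    have M: "q k \<in> M" "y \<in> M" "A' y \<in> M" using N y NM A'N by auto
    have "B (A x - A (q k)) y = B (x - q k) (A' y)"
      using M x y by (metis linear_map_on_diff[OF subspace_M lin_A] adj M_diff)
    also have "(\<dots>)\<^sup>2 \<le> \<bar>\<epsilon> k\<bar> * B (A' y) (A' y)"
      using near_proj_nonneg_eps[OF q(1)[of k]] A'N[OF y] by (auto simp: near_proj_def)
    also have "\<dots> \<le> \<bar>\<epsilon> k\<bar> * (a * B y y)" using bdd[OF y] by (intro mult_left_mono) auto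
    finally show "(B (A x - A (q k)) y)\<^sup>2 \<le> \<bar>\<epsilon> k\<bar> * a * B y y" by (simp add: mult.assoc)
  qed
  moreover have "(\<lambda>k. \<bar>\<epsilon> k\<bar> * a) \<longlonglongrightarrow> \<bar>0\<bar> * a" by (intro tendsto_intros q)
  then have "(\<lambda>k. \<bar>\<epsilon> k\<bar> * a) \<longlonglongrightarrow> 0" by simp
  moreover have "(\<lambda>k. e (A (q k))) \<longlonglongrightarrow> C w"
    using bounded_linear.tendsto[OF C q(3)] by (simp add: eA N)
  ultimately show ?thesis by (rule proj_valueI)
qed

lemma proj_value_bound:
  assumes x: "x \<in> M" "proj_value x w"
  shows "(norm w)\<^sup>2 \<le> B x x"
proof -
  obtain q \<epsilon> where q: "\<And>k. near_proj x (q k) (\<epsilon> k)" "\<epsilon> \<longlonglongrightarrow> 0" "(\<lambda>k. e (q k)) \<longlonglongrightarrow> w"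
    using x unfolding proj_value_def by blast
  have le: "norm (e (q k)) \<le> sqrt (B x x) + sqrt \<bar>\<epsilon> k\<bar>" for k
  proof -
    have N: "q k \<in> N" using q by (auto simp: near_proj_def)
    then have M: "q k \<in> M" using NM by auto
    define s where "s = sqrt (B (q k) (q k))"
    have s: "0 \<le> s" "B (q k) (q k) = s\<^sup>2" using B_nonneg[OF M] by (auto simp: s_def)
    have "\<bar>B x (q k)\<bar> \<le> sqrt (B x x) * s"
      using real_sqrt_le_mono[OF B_Cauchy_Schwarz[OF x(1) M]] by (simp add: real_sqrt_mult s_def)
    moreover have "(B (x - q k) (q k))\<^sup>2 \<le> \<bar>\<epsilon> k\<bar> * B (q k) (q k)"
      using near_proj_nonneg_eps[OF q(1)[of k]] N by (auto simp: near_proj_def)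
    from real_sqrt_le_mono[OF this] have "\<bar>B (x - q k) (q k)\<bar> \<le> sqrt \<bar>\<epsilon> k\<bar> * s"
      by (simp add: real_sqrt_mult s_def)
    moreover have "s\<^sup>2 = B x (q k) - B (x - q k) (q k)" using x M s by (simp add: B_diff)
    ultimately have "s * s \<le> (sqrt (B x x) + sqrt \<bar>\<epsilon> k\<bar>) * s"
      by (simp add: power2_eq_square distrib_right)
    then have "s \<le> sqrt (B x x) + sqrt \<bar>\<epsilon> k\<bar>"
      using s B_nonneg[OF x(1)] by (cases "s = 0") (auto simp: mult_le_cancel_right)
    moreover have "norm (e (q k)) \<le> s"
      using bound_e[OF N] s by (metis power2_le_imp_le)
    ultimately show ?thesis by linarith
  qed
  have "(\<lambda>k. sqrt (B x x) + sqrt \<bar>\<epsilon> k\<bar>) \<longlonglongrightarrow> sqrt (B x x) + sqrt \<bar>0\<bar>"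
    by (intro tendsto_intros q)
  then have "norm w \<le> sqrt (B x x) + sqrt \<bar>0\<bar>"
    using le tendsto_norm[OF q(3)] by (intro LIMSEQ_le[of _ "norm w"]) auto
  then have "(norm w)\<^sup>2 \<le> (sqrt (B x x))\<^sup>2" by (intro power_mono) auto
  then show ?thesis using B_nonneg[OF x(1)] by simp
qed

definition proj_extension :: "'a \<Rightarrow> 'w" where
  "proj_extension x = (THE w. proj_value x w)"

lemma proj_extension_eqI: "x \<in> M \<Longrightarrow> proj_value x w \<Longrightarrow> proj_extension x = w"
  unfolding proj_extension_def by (rule the_equality) (auto intro: proj_value_unique)

lemma proj_value_extension: "x \<in> M \<Longrightarrow> proj_value x (proj_extension x)"
  using proj_value_exists proj_extension_eqI by metis

lemma proj_extension_eq: "x \<in> N \<Longrightarrow> proj_extension x = e x"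
  using NM by (intro proj_extension_eqI proj_value_self) auto

lemma proj_extension_bound: "x \<in> M \<Longrightarrow> (norm (proj_extension x))\<^sup>2 \<le> B x x"
  by (intro proj_value_bound proj_value_extension)

lemma proj_extension_map:
  assumes "x \<in> M"
    and "linear_map_on M A" "\<And>x. x \<in> M \<Longrightarrow> A x \<in> M" "\<And>x. x \<in> N \<Longrightarrow> A x \<in> N"
    and "\<And>x. x \<in> N \<Longrightarrow> A' x \<in> N"
    and "\<And>x y. x \<in> M \<Longrightarrow> y \<in> N \<Longrightarrow> B (A x) y = B x (A' y)"
    and "\<And>y. y \<in> N \<Longrightarrow> B (A' y) (A' y) \<le> a * B y y"
    and "bounded_linear C" "\<And>x. x \<in> N \<Longrightarrow> e (A x) = C (e x)"
  shows "proj_extension (A x) = C (proj_extension x)"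
  by (rule proj_extension_eqI, simp add: assms, rule proj_value_map[where A' = A' and a = a])
     (use assms in \<open>auto intro: proj_value_extension\<close>)

lemma proj_extension_linear: "linear_map_on M proj_extension"
  unfolding linear_map_on_def
proof (intro conjI ballI allI)
  show "proj_extension (x + y) = proj_extension x + proj_extension y" if "x \<in> M" "y \<in> M" for x y
    using that by (intro proj_extension_eqI proj_value_add proj_value_extension M_add)
  show "proj_extension (r *\<^sub>R x) = r *\<^sub>R proj_extension x" if x: "x \<in> M" for r x
  proof (rule proj_extension_map[OF x, where A' = "\<lambda>x. r *\<^sub>R x" and a = "r\<^sup>2"])
    show "linear_map_on M (\<lambda>x. r *\<^sub>R x)"
      by (simp add: linear_map_on_def scaleR_add_right mult.commute)
    show "bounded_linear (\<lambda>x. r *\<^sub>R x :: 'w)" by (rule bounded_linear_scaleR_right)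
  qed (use NM subspace_N lin_e in \<open>auto simp: M_scale subspace_scale B_scale B_scale_right subset_iff
         power2_eq_square linear_map_on_scale\<close>)
qed

end

end

section \<open>One-step extensions\<close>

locale commutant_lifting =
  fixes S S' P :: "'k::{real_inner, complete_space} \<Rightarrow> 'k" and \<A> :: "('k \<Rightarrow> 'k) set" and c :: real
  assumes bounded_linear_S: "bounded_linear S" and bounded_linear_S': "bounded_linear S'"
    and S_adjoint: "inner (S x) y = inner x (S' y)"
    and S'_S [simp]: "S' (S x) = x"
    and c_nonneg: "0 \<le> c"
    and \<A>_bounded_linear: "A \<in> \<A> \<Longrightarrow> bounded_linear A"
    and \<A>_S: "A \<in> \<A> \<Longrightarrow> A (S x) = S (A x)"
    and \<A>_S': "A \<in> \<A> \<Longrightarrow> A (S' x) = S' (A x)"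
    and \<A>_adjoint: "A \<in> \<A> \<Longrightarrow> \<exists>A'\<in>\<A>. \<forall>x y. inner (A x) y = inner x (A' y)"
    and P_in: "P \<in> \<A>"
    and \<A>_norm: "A \<in> \<A> \<Longrightarrow> \<exists>r. \<forall>x. P x = x \<longrightarrow> (norm (A x))\<^sup>2 = r * (norm x)\<^sup>2"
begin

sublocale S: bounded_linear S by (rule bounded_linear_S)
sublocale S': bounded_linear S' by (rule bounded_linear_S')

definition E :: "'k \<Rightarrow> 'k" where
  "E x = x - S (S' x)"

lemma norm_S: "norm (S x) = norm x"
  using S_adjoint[of x "S x"] by (simp add: norm_eq_sqrt_inner)

lemma S'_E [simp]: "S' (E x) = 0"
  by (simp add: E_def S'.diff)

lemma bounded_linear_E: "bounded_linear E"
  unfolding E_def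
  by (intro bounded_linear_sub bounded_linear_ident bounded_linear_compose[OF bounded_linear_S bounded_linear_S'])

sublocale E: bounded_linear E by (rule bounded_linear_E)

lemma norm_S_plus_E: "(norm (S x + E y))\<^sup>2 = (norm x)\<^sup>2 + (norm (E y))\<^sup>2"
proof -
  have "inner (S x) (E y) = 0" by (simp add: S_adjoint)
  then have "(norm (S x + E y))\<^sup>2 = (norm (S x))\<^sup>2 + (norm (E y))\<^sup>2"
    by (simp add: power2_norm_eq_inner inner_add_left inner_add_right inner_commute)
  then show ?thesis by (simp add: norm_S)
qed

lemma norm_decomp: "(norm x)\<^sup>2 = (norm (S' x))\<^sup>2 + (norm (E x))\<^sup>2"
  using norm_S_plus_E[of "S' x" x] by (simp add: E_def)

lemma norm_S'_le: "norm (S' x) \<le> norm x"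
  by (rule power2_le_imp_le) (simp_all add: norm_decomp[of x])

lemma norm_E_le: "norm (E x) \<le> norm x"
  by (rule power2_le_imp_le) (simp_all add: norm_decomp[of x])

lemma \<A>_E: "A \<in> \<A> \<Longrightarrow> A (E x) = E (A x)"
  by (simp add: E_def \<A>_S \<A>_S' linear_diff bounded_linear.linear[OF \<A>_bounded_linear])

definition partial_lift :: "'k set \<Rightarrow> ('k \<Rightarrow> 'k) \<Rightarrow> bool" where
  "partial_lift N G \<longleftrightarrow> subspace N \<and> linear_map_on N G \<and>
     (\<forall>x\<in>N. S' x \<in> N \<and> P x = x \<and> norm (G x) \<le> c * norm x \<and> G (S' x) = S' (G x)) \<and>
     (\<forall>A\<in>\<A>. \<forall>x\<in>N. A x \<in> N \<and> G (A x) = A (G x))"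

definition enlarge :: "'k set \<Rightarrow> 'k set" where
  "enlarge N = {x + S y | x y. x \<in> N \<and> y \<in> N}"

lemma subspace_enlarge:
  assumes "subspace N"
  shows "subspace (enlarge N)"
proof -
  have "enlarge N = {x + y | x y. x \<in> N \<and> y \<in> S ` N}" by (auto simp: enlarge_def)
  moreover have "subspace (S ` N)"
    using linear_subspace_image[OF S.linear assms] .
  ultimately show ?thesis using subspace_sums[OF assms] by simp
qed

lemma enlargeI: "x \<in> N \<Longrightarrow> y \<in> N \<Longrightarrow> x + S y \<in> enlarge N"
  by (auto simp: enlarge_def)

lemma subset_enlarge: "subspace N \<Longrightarrow> N \<subseteq> enlarge N"
  using enlargeI[of _ N 0] by (auto simp: S.zero subspace_0)

lemma S_enlarge: "subspace N \<Longrightarrow> x \<in> N \<Longrightarrow> S x \<in> enlarge N"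
  using enlargeI[of 0 N x] by (simp add: subspace_0)

lemma partial_liftD:
  assumes "partial_lift N G"
  shows "subspace N" "linear_map_on N G"
    and "x \<in> N \<Longrightarrow> S' x \<in> N" "x \<in> N \<Longrightarrow> P x = x" "x \<in> N \<Longrightarrow> norm (G x) \<le> c * norm x"
    and "x \<in> N \<Longrightarrow> G (S' x) = S' (G x)"
    and "A \<in> \<A> \<Longrightarrow> x \<in> N \<Longrightarrow> A x \<in> N" "A \<in> \<A> \<Longrightarrow> x \<in> N \<Longrightarrow> G (A x) = A (G x)"
proof -
  note * = assms[unfolded partial_lift_def]
  note x = *[THEN conjunct2, THEN conjunct2, THEN conjunct1]
    and A = *[THEN conjunct2, THEN conjunct2, THEN conjunct2]
  show "subspace N" by (rule *[THEN conjunct1])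
  show "linear_map_on N G" by (rule *[THEN conjunct2, THEN conjunct1])
  show "S' x \<in> N" "P x = x" "norm (G x) \<le> c * norm x" "G (S' x) = S' (G x)" if "x \<in> N"
    using bspec[OF x that] by (simp_all only:)
  show "A x \<in> N" "G (A x) = A (G x)" if "A \<in> \<A>" "x \<in> N"
    using bspec[OF bspec[OF A that(1)] that(2)] by (simp_all only:)
qed

lemma partial_lift_step:
  assumes G: "partial_lift N G"
  shows "\<exists>G'. partial_lift (enlarge N) G' \<and> (\<forall>x\<in>N. G' x = G x)"
proof -
  let ?M = "enlarge N"
  note sub = partial_liftD(1)[OF G] and lin = partial_liftD(2)[OF G]
    and S'N = partial_liftD(3)[OF G] and PN = partial_liftD(4)[OF G]
    and nG = partial_liftD(5)[OF G] and GS' = partial_liftD(6)[OF G]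
    and AN = partial_liftD(7)[OF G] and GA = partial_liftD(8)[OF G]
  have NM: "N \<subseteq> ?M" by (rule subset_enlarge[OF sub])
  have S'M: "S' x \<in> N" if x: "x \<in> ?M" for x
  proof -
    obtain u v where uv: "x = u + S v" "u \<in> N" "v \<in> N" using x unfolding enlarge_def by blast
    have "S' x = S' u + v" by (simp add: uv S'.add)
    then show ?thesis using subspace_add[OF sub S'N[OF uv(2)] uv(3)] by simp
  qed
  have PM: "P x = x" if x: "x \<in> ?M" for x
  proof -
    obtain u v where uv: "x = u + S v" "u \<in> N" "v \<in> N" using x unfolding enlarge_def by blast
    show ?thesis
      by (simp add: uv linear_add[OF bounded_linear.linear[OF \<A>_bounded_linear[OF P_in]]] PN \<A>_S[OF P_in])
  qed
  have AM: "A x \<in> ?M" if A: "A \<in> \<A>" and x: "x \<in> ?M" for A x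
  proof -
    obtain u v where uv: "x = u + S v" "u \<in> N" "v \<in> N" using x unfolding enlarge_def by blast
    have "A x = A u + S (A v)"
      using linear_add[OF bounded_linear.linear[OF \<A>_bounded_linear[OF A]]] \<A>_S[OF A] by (simp add: uv)
    then show ?thesis using enlargeI[OF AN[OF A uv(2)] AN[OF A uv(3)]] by simp
  qed
  define B where "B x y = c\<^sup>2 * inner x y - inner (G (S' x)) (G (S' y))" for x y
  define e where "e x = E (G x)" for x
  interpret B: semi_inner ?M B
  proof
    show "subspace ?M" by (rule subspace_enlarge[OF sub])
    show "B x y = B y x" for x y by (simp add: B_def inner_commute)
    show "B (x + y) z = B x z + B y z" if "x \<in> ?M" "y \<in> ?M" for x y z
      using S'M that by (simp add: B_def S'.add linear_map_on_add[OF lin] inner_add_left algebra_simps)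
    show "B (r *\<^sub>R x) y = r * B x y" if "x \<in> ?M" for r x y
      using S'M that by (simp add: B_def S'.scaleR linear_map_on_scale[OF lin] algebra_simps)
    show "0 \<le> B x x" if x: "x \<in> ?M" for x
    proof -
      have "norm (G (S' x)) \<le> c * norm (S' x)" by (rule nG[OF S'M[OF x]])
      also have "\<dots> \<le> c * norm x" by (rule mult_left_mono[OF norm_S'_le c_nonneg])
      finally have "(norm (G (S' x)))\<^sup>2 \<le> (c * norm x)\<^sup>2" by (rule power_mono) simp
      then show ?thesis by (simp add: B_def power2_norm_eq_inner power_mult_distrib)
    qed
  qed
  have lin_e: "linear_map_on N e"
    using lin by (simp add: linear_map_on_def e_def E.add E.scaleR)
  have bound_e: "(norm (e x))\<^sup>2 \<le> B x x" if x: "x \<in> N" for x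
  proof -
    have "(norm (e x))\<^sup>2 = (norm (G x))\<^sup>2 - (norm (G (S' x)))\<^sup>2"
      using norm_decomp[of "G x"] by (simp add: e_def GS'[OF x])
    moreover have "(norm (G x))\<^sup>2 \<le> (c * norm x)\<^sup>2" by (rule power_mono[OF nG[OF x]]) simp
    ultimately show ?thesis by (simp add: B_def power2_norm_eq_inner power_mult_distrib)
  qed
  define e' where "e' = B.proj_extension N e"
  note ext = sub NM lin_e bound_e
  have e'_eq: "e' x = e x" if "x \<in> N" for x
    unfolding e'_def by (rule B.proj_extension_eq[OF ext that])
  have e'_bound: "(norm (e' x))\<^sup>2 \<le> B x x" if "x \<in> ?M" for x
    unfolding e'_def by (rule B.proj_extension_bound[OF ext that])
  have e'_lin: "linear_map_on ?M e'"
    unfolding e'_def by (rule B.proj_extension_linear[OF ext])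
  have e'_A: "e' (A x) = A (e' x)" if A: "A \<in> \<A>" and x: "x \<in> ?M" for A x
  proof -
    obtain A' where A': "A' \<in> \<A>" and adj: "\<And>x y. inner (A x) y = inner x (A' y)"
      using \<A>_adjoint[OF A] by blast
    obtain r where r: "\<And>x. P x = x \<Longrightarrow> (norm (A' x))\<^sup>2 = r * (norm x)\<^sup>2" using \<A>_norm[OF A'] by blast
    show ?thesis
      unfolding e'_def
    proof (rule B.proj_extension_map[OF ext x, where A' = A' and a = r])
      show "linear_map_on ?M A"
        using bounded_linear.linear[OF \<A>_bounded_linear[OF A]]
        by (simp add: linear_map_on_def linear_add linear_scale)
      show "bounded_linear A" by (rule \<A>_bounded_linear[OF A])
      show "B (A x) y = B x (A' y)" if "x \<in> ?M" "y \<in> N" for x y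
        using that S'M NM
        by (simp add: B_def adj \<A>_S'[OF A, symmetric] \<A>_S'[OF A', symmetric] GA[OF A] GA[OF A'] subset_iff)
      show "B (A' y) (A' y) \<le> r * B y y" if y: "y \<in> N" for y
      proof -
        have "P (G (S' y)) = G (S' y)" using GA[OF P_in S'N[OF y]] PN[OF S'N[OF y]] by simp
        then have "inner (A' (G (S' y))) (A' (G (S' y))) = r * inner (G (S' y)) (G (S' y))"
          using r by (simp add: power2_norm_eq_inner)
        moreover have "inner (A' y) (A' y) = r * inner y y"
          using r[OF PN[OF y]] by (simp add: power2_norm_eq_inner)
        ultimately show ?thesis
          by (simp add: B_def \<A>_S'[OF A', symmetric] GA[OF A' S'N[OF y]] algebra_simps)
      qed
      show "e (A x) = A (e x)" if "x \<in> N" for x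
        by (simp add: e_def GA[OF A that] \<A>_E[OF A])
    qed (use AM[OF A] AN[OF A] AN[OF A'] in auto)
  qed
  define G' where "G' x = S (G (S' x)) + E (e' x)" for x
  have eq: "G' x = G x" if x: "x \<in> N" for x
    by (simp add: G'_def e'_eq[OF x] e_def GS'[OF x]) (simp add: E_def S'.diff S.diff S.zero)
  have "partial_lift ?M G'"
    unfolding partial_lift_def
  proof (intro conjI ballI)
    show "subspace ?M" by (rule subspace_enlarge[OF sub])
    show "linear_map_on ?M G'"
      using S'M linear_map_on_add[OF lin] linear_map_on_scale[OF lin] linear_map_on_add[OF e'_lin] linear_map_on_scale[OF e'_lin]
      by (simp add: linear_map_on_def G'_def S'.add S'.scaleR S.add S.scaleR E.add E.scaleR scaleR_add_right)
    show "S' x \<in> ?M" if "x \<in> ?M" for x using S'M[OF that] NM by auto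
    show "P x = x" if "x \<in> ?M" for x by (rule PM[OF that])
    show "norm (G' x) \<le> c * norm x" if x: "x \<in> ?M" for x
    proof (rule power2_le_imp_le)
      have "(norm (E (e' x)))\<^sup>2 \<le> B x x"
        using power_mono[OF norm_E_le[of "e' x"], of 2] e'_bound[OF x] by (simp del: power_mono_iff)
      then show "(norm (G' x))\<^sup>2 \<le> (c * norm x)\<^sup>2"
        by (simp add: G'_def norm_S_plus_E B_def power2_norm_eq_inner[symmetric] power_mult_distrib)
      show "0 \<le> c * norm x" using c_nonneg by simp
    qed
    show "G' (S' x) = S' (G' x)" if x: "x \<in> ?M" for x
      using eq[OF S'M[OF x]] by (simp add: G'_def S'.add)
    show "A x \<in> ?M" if "A \<in> \<A>" "x \<in> ?M" for A x by (rule AM[OF that])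
    show "G' (A x) = A (G' x)" if A: "A \<in> \<A>" and x: "x \<in> ?M" for A x
      using linear_add[OF bounded_linear.linear[OF \<A>_bounded_linear[OF A]]]
      by (simp add: G'_def e'_A[OF A x] \<A>_E[OF A] \<A>_S[OF A] \<A>_S'[OF A, symmetric] GA[OF A S'M[OF x], symmetric])
  qed
  with eq show ?thesis by (intro exI[of _ G'] conjI ballI)
qed

theorem commutant_lift:
  assumes G0: "partial_lift N0 G0"
  shows "\<exists>G. bounded_linear G \<and> (\<forall>x. norm (G x) \<le> c * norm x) \<and> (\<forall>x\<in>N0. G x = G0 x) \<and>
    (\<forall>x. G (S' x) = S' (G x)) \<and> (\<forall>A\<in>\<A>. \<forall>x. G (A x) = A (G x))"
proof -
  define N where "N m = (enlarge ^^ m) N0" for m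
  have N_Suc: "N (Suc m) = enlarge (N m)" for m by (simp add: N_def)
  have "\<exists>g. \<forall>m. partial_lift (N m) (g m) \<and> (m = 0 \<longrightarrow> (\<forall>x\<in>N0. g m x = G0 x)) \<and> (\<forall>x\<in>N m. g (Suc m) x = g m x)"
  proof (rule dependent_nat_choice[where P = "\<lambda>m G. partial_lift (N m) G \<and> (m = 0 \<longrightarrow> (\<forall>x\<in>N0. G x = G0 x))"
        and Q = "\<lambda>m G G'. \<forall>x\<in>N m. G' x = G x", simplified conj_assoc])
    show "\<exists>G. partial_lift (N 0) G \<and> (0 = 0 \<longrightarrow> (\<forall>x\<in>N0. G x = G0 x))"
      using G0 by (auto simp: N_def)
    show "\<exists>G'. partial_lift (N (Suc m)) G' \<and> (Suc m = 0 \<longrightarrow> (\<forall>x\<in>N0. G' x = G0 x)) \<and> (\<forall>x\<in>N m. G' x = G x)"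
      if "partial_lift (N m) G \<and> (m = 0 \<longrightarrow> (\<forall>x\<in>N0. G x = G0 x))" for G m
      using partial_lift_step that by (auto simp: N_Suc)
  qed
  then obtain g where g: "\<And>m. partial_lift (N m) (g m)" "\<And>x. x \<in> N0 \<Longrightarrow> g 0 x = G0 x"
    and g_Suc: "\<And>m x. x \<in> N m \<Longrightarrow> g (Suc m) x = g m x" by blast
  have sub: "subspace (N m)" for m by (rule partial_liftD(1)[OF g(1)])
  have mono: "N m \<subseteq> N (m + k)" for m k
    by (induction k) (use subset_enlarge[OF sub] in \<open>auto simp: N_Suc\<close>)
  have g_add: "g (m + k) x = g m x" if "x \<in> N m" for m k x
  proof (induction k)
    case (Suc k)
    then show ?case using g_Suc[OF subsetD[OF mono[of m k] that]] by simp
  qed simp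
  define U where "U = (\<Union>m. N m)"
  define h where "h x = g (LEAST m. x \<in> N m) x" for x
  have h: "h x = g m x" if x: "x \<in> N m" for x m
  proof -
    let ?l = "LEAST m. x \<in> N m"
    have "x \<in> N ?l" "?l \<le> m" using x by (auto intro: LeastI Least_le)
    then show ?thesis using g_add[of x ?l "m - ?l"] by (simp add: h_def)
  qed
  have two: "\<exists>m. x \<in> N m \<and> y \<in> N m" if "x \<in> U" "y \<in> U" for x y
    using that mono unfolding U_def by (metis UN_E add.commute subsetD)
  have one: "\<exists>m. x \<in> N m" if "x \<in> U" for x
    using that by (auto simp: U_def)
  have NU: "x \<in> U" if "x \<in> N m" for x m using that by (auto simp: U_def)
  have subU: "subspace U"
    unfolding subspace_def
  proof (intro conjI ballI allI)
    show "0 \<in> U" using subspace_0[OF sub] NU by blast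
    show "x + y \<in> U" if "x \<in> U" "y \<in> U" for x y
      using two[OF that] subspace_add[OF sub] NU by blast
    show "r *\<^sub>R x \<in> U" if "x \<in> U" for r x
      using one[OF that] subspace_scale[OF sub] NU by blast
  qed
  have lin: "linear_map_on U h"
    unfolding linear_map_on_def
  proof (intro conjI ballI allI)
    show "h (x + y) = h x + h y" if xy: "x \<in> U" "y \<in> U" for x y
    proof -
      obtain m where m: "x \<in> N m" "y \<in> N m" using two[OF xy] by blast
      then show ?thesis
        by (simp add: h[of _ m] subspace_add[OF sub] linear_map_on_add[OF partial_liftD(2)[OF g(1)]])
    qed
    show "h (r *\<^sub>R x) = r *\<^sub>R h x" if x: "x \<in> U" for r x
    proof -
      obtain m where m: "x \<in> N m" using one[OF x] by blast
      then show ?thesis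
        by (simp add: h[of _ m] subspace_scale[OF sub] linear_map_on_scale[OF partial_liftD(2)[OF g(1)]])
    qed
  qed
  have S'U: "S' x \<in> U" "h (S' x) = S' (h x)" and bU: "norm (h x) \<le> c * norm x"
    and AU: "A \<in> \<A> \<Longrightarrow> A x \<in> U" "A \<in> \<A> \<Longrightarrow> h (A x) = A (h x)" and SU: "S x \<in> U" if x: "x \<in> U" for x A
  proof -
    obtain m where m: "x \<in> N m" using one[OF x] by blast
    have p: "S' x \<in> N m" "A \<in> \<A> \<Longrightarrow> A x \<in> N m"
      "norm (g m x) \<le> c * norm x" "g m (S' x) = S' (g m x)" "A \<in> \<A> \<Longrightarrow> g m (A x) = A (g m x)"
      using partial_liftD[OF g(1)[of m]] m by simp_all
    show "S' x \<in> U" "A \<in> \<A> \<Longrightarrow> A x \<in> U" using p NU by blast+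
    show "h (S' x) = S' (h x)" "norm (h x) \<le> c * norm x" "A \<in> \<A> \<Longrightarrow> h (A x) = A (h x)"
      using p m by (simp_all add: h[of _ m])
    show "S x \<in> U" using S_enlarge[OF sub m] NU[of _ "Suc m"] by (simp add: N_Suc)
  qed
  define B where "B x y = c\<^sup>2 * inner x y" for x y :: 'k
  interpret B: semi_inner UNIV B
    by unfold_locales (auto simp: B_def inner_add_left algebra_simps intro: inner_commute)
  have bound: "(norm (h x))\<^sup>2 \<le> B x x" if "x \<in> U" for x
    using power_mono[OF bU[OF that], of 2] by (simp add: B_def power_mult_distrib power2_norm_eq_inner)
  note ext = subU subset_UNIV lin bound
  define G where "G = B.proj_extension U h"
  have Gx: "G x = h x" if "x \<in> U" for x unfolding G_def by (rule B.proj_extension_eq[OF ext that])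
  have bG: "norm (G x) \<le> c * norm x" for x
  proof (rule power2_le_imp_le)
    show "(norm (G x))\<^sup>2 \<le> (c * norm x)\<^sup>2"
      using B.proj_extension_bound[OF ext UNIV_I[of x]]
      by (simp add: G_def B_def power_mult_distrib power2_norm_eq_inner)
  qed (use c_nonneg in simp)
  have linG: "linear_map_on UNIV G"
    unfolding G_def by (rule B.proj_extension_linear[OF ext])
  have "bounded_linear G"
    by (rule bounded_linear_intro[where K = c])
       (use linG bG in \<open>auto simp: linear_map_on_def mult.commute\<close>)
  moreover have comm: "G (A x) = A (G x)"
    if A: "bounded_linear A" "bounded_linear A'" "\<And>x y. inner (A x) y = inner x (A' y)"
      and U: "\<And>x. x \<in> U \<Longrightarrow> A x \<in> U" "\<And>x. x \<in> U \<Longrightarrow> A' x \<in> U" "\<And>x. x \<in> U \<Longrightarrow> h (A x) = A (h x)" for A A' x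
  proof -
    obtain a where a: "\<And>x. norm (A' x) \<le> norm x * a" using bounded_linear.bounded[OF A(2)] by blast
    show ?thesis
      unfolding G_def
    proof (rule B.proj_extension_map[OF ext UNIV_I, where A' = A' and a = "a\<^sup>2"])
      show "linear_map_on UNIV A"
        using bounded_linear.linear[OF A(1)] by (simp add: linear_map_on_def linear_add linear_scale)
      show "B (A' y) (A' y) \<le> a\<^sup>2 * B y y" for y
        using mult_left_mono[OF power_mono[OF a[of y], of 2], of "c\<^sup>2"]
        by (simp add: B_def power2_norm_eq_inner power_mult_distrib mult_ac)
    qed (use A U in \<open>auto simp: B_def\<close>)
  qed
  moreover have "G (S' x) = S' (G x)" for x
    by (rule comm[OF bounded_linear_S' bounded_linear_S]) (use S'U SU S_adjoint in \<open>auto simp: inner_commute\<close>)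
  moreover have "G (A x) = A (G x)" if A: "A \<in> \<A>" for A x
  proof -
    obtain A' where "A' \<in> \<A>" "\<And>x y. inner (A x) y = inner x (A' y)" using \<A>_adjoint[OF A] by blast
    then show ?thesis
      using AU(1,2)[OF _ A] AU(1)[of _ A'] by (intro comm[of A A']) (simp_all add: \<A>_bounded_linear A)
  qed
  moreover have "G x = G0 x" if "x \<in> N0" for x
  proof -
    have "x \<in> N 0" using that by (simp add: N_def)
    then show ?thesis using Gx[OF NU] h g(2)[OF that] by metis
  qed
  ultimately show ?thesis using bG by (intro exI[of _ G] conjI ballI allI)
qed

end

section \<open>Adjoints\<close>

lemma inner_eqI: "(\<And>y. inner u y = inner v y) \<Longrightarrow> u = v" for u v :: "'a::real_inner"
  by (metis inner_diff_left inner_eq_zero_iff right_minus_eq)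

lemma Im_cinner: "Im (cinner x y) = - inner (\<i> *\<^sub>C x) y"
  by (simp add: inner_eq_Re_cinner cinner_scaleC_left)

lemma bounded_clinearD:
  assumes "bounded_clinear A"
  shows "bounded_linear A" "A (c *\<^sub>C x) = c *\<^sub>C A x"
  using assms by (auto simp: bounded_clinear_def)

lemma inner_scaleC_left: "inner (c *\<^sub>C x) y = inner x (cnj c *\<^sub>C y)" for x y :: "'a::complex_inner"
  by (simp add: inner_eq_Re_cinner cinner_scaleC_left cinner_scaleC_right)

lemma cinner_adjointI:
  assumes A: "bounded_clinear A" and adj: "\<And>x y. inner (A x) y = inner x (B y)"
  shows "cinner (A x) y = cinner x (B y)"
  by (rule complex_eqI)
     (simp_all add: Im_cinner inner_eq_Re_cinner[symmetric] adj bounded_clinearD(2)[OF A, symmetric])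

lemma real_adjoint_exists:
  fixes A :: "'a::{real_inner, complete_space} \<Rightarrow> 'b::real_inner"
  assumes "bounded_linear A"
  shows "\<exists>B. \<forall>x y. inner (A x) y = inner x (B y)"
proof -
  have "\<exists>q. \<forall>x. inner (A x) y = inner q x" for y
    by (rule Riesz_representation) (rule bounded_linear_compose[OF bounded_linear_inner_left assms])
  then show ?thesis by (metis inner_commute)
qed

lemma inner_cadjoint:
  fixes A :: "'a::chilbert_space \<Rightarrow> 'b::complex_inner"
  assumes A: "bounded_clinear A"
  shows "inner (A x) y = inner x (cadjoint A y)"
proof -
  have "\<exists>B. \<forall>x y. cinner (A x) y = cinner x (B y)"
    using real_adjoint_exists[OF bounded_clinearD(1)[OF A]] cinner_adjointI[OF A] by metis
  then have "\<forall>x y. cinner (A x) y = cinner x (cadjoint A y)"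
    unfolding cadjoint_def by (rule someI_ex)
  then show ?thesis by (simp add: inner_eq_Re_cinner)
qed

lemma cadjoint_eqI:
  fixes A :: "'a::chilbert_space \<Rightarrow> 'b::complex_inner"
  assumes A: "bounded_clinear A" and adj: "\<And>x y. inner (A x) y = inner x (B y)"
  shows "cadjoint A = B"
proof
  fix y show "cadjoint A y = B y"
    by (rule inner_eqI) (metis adj inner_cadjoint[OF A] inner_commute)
qed

lemma norm_adjoint_le:
  fixes A :: "'a::real_inner \<Rightarrow> 'b::real_inner"
  assumes bound: "\<And>x. norm (A x) \<le> c * norm x" and adj: "\<And>x y. inner (A x) y = inner x (B y)" and c: "0 \<le> c"
  shows "norm (B y) \<le> c * norm y"
proof (cases "B y = 0")
  case True
  then show ?thesis using c by simp
next
  case False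
  have "norm (B y) * norm (B y) = inner (A (B y)) y"
    by (simp add: adj power2_norm_eq_inner[symmetric] power2_eq_square)
  also have "\<dots> \<le> norm (A (B y)) * norm y" by (rule norm_cauchy_schwarz)
  also have "\<dots> \<le> c * norm (B y) * norm y" by (rule mult_right_mono[OF bound norm_ge_zero])
  finally have "norm (B y) * norm (B y) \<le> c * norm y * norm (B y)" by (simp add: mult_ac)
  then show ?thesis using False by simp
qed

lemma bounded_clinear_adjoint:
  assumes A: "bounded_clinear A" and bound: "\<And>x. norm (A x) \<le> c * norm x" and c: "0 \<le> c"
    and adj: "\<And>x y. inner (A x) y = inner x (B y)"
  shows "bounded_clinear B"
  unfolding bounded_clinear_def
proof (intro conjI allI)
  have eqI: "B u = v" if "\<And>x. inner (A x) u = inner x v" for u v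
    by (rule inner_eqI) (metis that adj inner_commute)
  show "bounded_linear B"
  proof (rule bounded_linear_intro[where K = c])
    show "B (x + y) = B x + B y" for x y by (rule eqI) (simp add: adj inner_add_right)
    show "B (r *\<^sub>R x) = r *\<^sub>R B x" for r x by (rule eqI) (simp add: adj)
    show "norm (B x) \<le> norm x * c" for x using norm_adjoint_le[OF bound adj c] by (simp add: mult.commute)
  qed
  show "B (d *\<^sub>C x) = d *\<^sub>C B x" for d x
  proof (rule eqI)
    fix u
    have "inner (A u) (d *\<^sub>C x) = inner (A (cnj d *\<^sub>C u)) x"
      by (simp add: bounded_clinearD(2)[OF A] inner_scaleC_left)
    then show "inner (A u) (d *\<^sub>C x) = inner u (d *\<^sub>C B x)" by (simp add: adj inner_scaleC_left)
  qed
qed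

lemma bounded_clinear_onorm: "bounded_clinear A \<Longrightarrow> norm (A x) \<le> onorm A * norm x"
  using onorm by (auto simp: bounded_clinear_def)

lemma onorm_nonneg: "bounded_clinear A \<Longrightarrow> 0 \<le> onorm A"
  using onorm_pos_le by (auto simp: bounded_clinear_def)

lemma bounded_clinear_cadjoint:
  fixes A :: "'a::chilbert_space \<Rightarrow> 'b::complex_inner"
  assumes "bounded_clinear A"
  shows "bounded_clinear (cadjoint A)"
  by (rule bounded_clinear_adjoint[OF assms bounded_clinear_onorm[OF assms] onorm_nonneg[OF assms] inner_cadjoint[OF assms]])

lemma norm_cadjoint_le:
  fixes A :: "'a::chilbert_space \<Rightarrow> 'b::complex_inner"
  assumes "bounded_clinear A"
  shows "norm (cadjoint A x) \<le> onorm A * norm x"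
  by (rule norm_adjoint_le[OF bounded_clinear_onorm[OF assms] inner_cadjoint[OF assms] onorm_nonneg[OF assms]])

lemma isometry_inner:
  assumes A: "bounded_linear A" and iso: "\<And>x. norm (A x) = norm x"
  shows "inner (A x) (A y) = inner x y"
proof -
  have "inner (A x) (A y) = ((norm (A (x + y)))\<^sup>2 - (norm (A x))\<^sup>2 - (norm (A y))\<^sup>2) / 2"
    by (simp add: linear_add[OF bounded_linear.linear[OF A]] power2_norm_eq_inner
        inner_add_left inner_add_right inner_commute)
  also have "\<dots> = inner x y"
    by (simp only: iso) (simp add: power2_norm_eq_inner inner_add_left inner_add_right inner_commute)
  finally show ?thesis .
qed

section \<open>Pure tuples of isometries with vanishing defects\<close>

text \<open>\<open>V' i\<close> is the adjoint of \<open>V i\<close>; a word \<open>w\<close> denotes the product \<open>foldr V w\<close>, whose adjoint is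
  \<open>fold V' w\<close>.\<close>

locale pure_isometric_tuple =
  fixes idx :: "'i list" and V V' :: "'i \<Rightarrow> 'k::chilbert_space \<Rightarrow> 'k"
  assumes distinct_idx: "distinct idx"
    and V_clinear: "i \<in> set idx \<Longrightarrow> bounded_clinear (V i)"
    and norm_V: "i \<in> set idx \<Longrightarrow> norm (V i x) = norm x"
    and V_adjoint: "i \<in> set idx \<Longrightarrow> inner (V i x) y = inner x (V' i y)"
    and V_commute: "i \<in> set idx \<Longrightarrow> j \<in> set idx \<Longrightarrow> V i (V j x) = V j (V i x)"
    and defect: "i \<in> set idx \<Longrightarrow> j \<in> set idx \<Longrightarrow> i \<noteq> j \<Longrightarrow>
      x - V i (V' i x) - V j (V' j x) + V i (V j (V' i (V' j x))) = 0"
    and pure: "(\<lambda>k. (fold V' idx ^^ k) x) \<longlonglongrightarrow> 0"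
begin

abbreviation I :: "'i set" where "I \<equiv> set idx"

lemma V_bounded_linear: "i \<in> I \<Longrightarrow> bounded_linear (V i)"
  by (rule bounded_clinearD(1)[OF V_clinear])

lemma V'_clinear:
  assumes "i \<in> I"
  shows "bounded_clinear (V' i)"
  by (rule bounded_clinear_adjoint[where c = 1, OF V_clinear[OF assms]])
     (simp_all add: assms norm_V V_adjoint)

lemma V'_bounded_linear: "i \<in> I \<Longrightarrow> bounded_linear (V' i)"
  by (rule bounded_clinearD(1)[OF V'_clinear])

lemmas V_linear = bounded_linear.linear[OF V_bounded_linear]

lemma norm_V'_le: "i \<in> I \<Longrightarrow> norm (V' i x) \<le> norm x"
  using norm_adjoint_le[of "V i" 1 "V' i" x] by (simp add: norm_V V_adjoint)

lemma V'_V: "i \<in> I \<Longrightarrow> V' i (V i x) = x"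
  by (rule inner_eqI) (metis V_adjoint inner_commute isometry_inner norm_V V_bounded_linear)

lemma V'_commute:
  assumes "i \<in> I" "j \<in> I"
  shows "V' i (V' j x) = V' j (V' i x)"
  by (rule inner_eqI) (metis assms V_adjoint V_commute inner_commute)

lemma V_funpow_adjoint: "i \<in> I \<Longrightarrow> inner ((V i ^^ k) x) y = inner x ((V' i ^^ k) y)"
  by (induction k arbitrary: x y) (simp_all add: V_adjoint funpow_swap1)

lemma norm_V_funpow: "i \<in> I \<Longrightarrow> norm ((V i ^^ k) x) = norm x"
  by (induction k) (simp_all add: norm_V)

lemma V_funpow_clinear: "i \<in> I \<Longrightarrow> bounded_clinear (V i ^^ k)"
  using V_clinear by (induction k) (auto simp: bounded_clinear_def id_def o_def
      intro: bounded_linear_compose bounded_linear_ident)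

lemma V'_funpow_clinear: "i \<in> I \<Longrightarrow> bounded_clinear (V' i ^^ k)"
  using V'_clinear by (induction k) (auto simp: bounded_clinear_def id_def o_def
      intro: bounded_linear_compose bounded_linear_ident)

definition defect_sum :: "'i \<Rightarrow> nat \<Rightarrow> 'k \<Rightarrow> 'k" where
  "defect_sum i k x = x - (V i ^^ k) ((V' i ^^ k) x)"

lemma defect_sum_0 [simp]: "defect_sum i 0 x = 0"
  by (simp add: defect_sum_def)

lemma defect_sum_Suc:
  "i \<in> I \<Longrightarrow> defect_sum i (Suc k) x = x - V i (V' i x) + V i (defect_sum i k (V' i x))"
  by (simp add: defect_sum_def linear_diff[OF V_linear] funpow_swap1)

lemma defect_sum_clinear:
  assumes i: "i \<in> I"
  shows "bounded_clinear (defect_sum i k)"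
proof -
  have b: "bounded_linear (V i ^^ k)" "bounded_linear (V' i ^^ k)"
    and c: "(V i ^^ k) (c *\<^sub>C x) = c *\<^sub>C (V i ^^ k) x" "(V' i ^^ k) (c *\<^sub>C x) = c *\<^sub>C (V' i ^^ k) x" for c x
    using bounded_clinearD[OF V_funpow_clinear[OF i]] bounded_clinearD[OF V'_funpow_clinear[OF i]] by blast+
  have "c *\<^sub>C (x - y) = c *\<^sub>C x - c *\<^sub>C y" for c and x y :: 'k
    by (rule linear_diff[OF bounded_linear.linear[OF bounded_linear_scaleC]])
  then show ?thesis
    unfolding bounded_clinear_def defect_sum_def
    using bounded_linear_sub[OF bounded_linear_ident bounded_linear_compose[OF b]] by (simp add: c)
qed

lemma defect_sum_conj:
  assumes i: "i \<in> I" and j: "j \<in> I" and ij: "i \<noteq> j"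
  shows "V j (defect_sum i k (V' j x)) = defect_sum i k x"
proof (induction k arbitrary: x)
  case 0
  then show ?case by (simp add: linear_0[OF V_linear[OF j]])
next
  case (Suc k)
  have "V j (defect_sum i (Suc k) (V' j x)) =
      V j (V' j x) - V i (V j (V' i (V' j x))) + V i (V j (defect_sum i k (V' j (V' i x))))"
    by (simp add: defect_sum_Suc[OF i] linear_add[OF V_linear[OF j]] linear_diff[OF V_linear[OF j]]
        V_commute[OF j i] V'_commute[OF i j])
  also have "V j (V' j x) - V i (V j (V' i (V' j x))) = x - V i (V' i x)"
    using defect[OF i j ij, of x] by (simp add: algebra_simps)
  finally show ?case by (simp add: Suc defect_sum_Suc[OF i])
qed

lemma fold_V'_linear: "set w \<subseteq> I \<Longrightarrow> bounded_clinear (fold V' w)"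
proof (induction w)
  case (Cons j w)
  then show ?case
    using V'_clinear[of j] by (auto simp: bounded_clinear_def o_def intro: bounded_linear_compose)
qed (simp add: bounded_clinear_def id_def bounded_linear_ident)

lemma foldr_V_linear: "set w \<subseteq> I \<Longrightarrow> bounded_clinear (foldr V w)"
proof (induction w)
  case (Cons j w)
  then show ?case
    using V_clinear[of j] by (auto simp: bounded_clinear_def o_def intro: bounded_linear_compose)
qed (simp add: bounded_clinear_def id_def bounded_linear_ident)

lemma norm_foldr_V: "set w \<subseteq> I \<Longrightarrow> norm (foldr V w x) = norm x"
  by (induction w) (simp_all add: norm_V)

lemma norm_fold_V'_le: "set w \<subseteq> I \<Longrightarrow> norm (fold V' w x) \<le> norm x"
proof (induction w arbitrary: x)
  case (Cons j w)
  then show ?case using order_trans[OF Cons.IH norm_V'_le[of j x]] by simp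
qed simp

lemma foldr_V_commute: "set w \<subseteq> I \<Longrightarrow> j \<in> I \<Longrightarrow> foldr V w (V j x) = V j (foldr V w x)"
  by (induction w) (simp_all add: V_commute)

lemma fold_V'_commute: "set w \<subseteq> I \<Longrightarrow> j \<in> I \<Longrightarrow> fold V' w (V' j x) = V' j (fold V' w x)"
proof (induction w arbitrary: x)
  case (Cons a w)
  then show ?case using V'_commute[of a j x] by simp
qed simp

lemma foldr_V_append_commute: "set w \<subseteq> I \<Longrightarrow> set u \<subseteq> I \<Longrightarrow> foldr V (w @ u) x = foldr V (u @ w) x"
  by (induction u arbitrary: x) (simp_all add: foldr_V_commute)

lemma fold_V'_append_commute: "set w \<subseteq> I \<Longrightarrow> set u \<subseteq> I \<Longrightarrow> fold V' (w @ u) x = fold V' (u @ w) x"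
  by (induction w arbitrary: x) (simp_all add: fold_V'_commute)

lemma word_defect:
  assumes "set w \<subseteq> I"
  shows "x - foldr V w (fold V' w x) = (\<Sum>i\<in>I. defect_sum i (count_list w i) x)"
  using assms
proof (induction w arbitrary: x)
  case (Cons j w)
  then have j: "j \<in> I" and w: "set w \<subseteq> I" by auto
  let ?y = "V' j x"
  have "x - foldr V (j # w) (fold V' (j # w) x) = x - V j ?y + V j (?y - foldr V w (fold V' w ?y))"
    by (simp add: linear_diff[OF V_linear[OF j]])
  also have "\<dots> = x - V j ?y + (\<Sum>i\<in>I. V j (defect_sum i (count_list w i) ?y))"
    by (simp add: Cons.IH[OF w] linear_sum[OF V_linear[OF j]])
  also have "\<dots> = x - V j ?y + V j (defect_sum j (count_list w j) ?y) +
      (\<Sum>i\<in>I-{j}. V j (defect_sum i (count_list w i) ?y))"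
    by (subst sum.remove[OF _ j]) (simp_all add: add.assoc)
  also have "\<dots> = defect_sum j (Suc (count_list w j)) x + (\<Sum>i\<in>I-{j}. defect_sum i (count_list w i) x)"
    by (simp add: defect_sum_Suc[OF j] defect_sum_conj[OF _ j])
  also have "\<dots> = (\<Sum>i\<in>I. defect_sum i (count_list (j # w) i) x)"
  proof -
    have "(\<Sum>i\<in>I-{j}. defect_sum i (count_list (j # w) i) x) = (\<Sum>i\<in>I-{j}. defect_sum i (count_list w i) x)"
      by (rule sum.cong) auto
    then show ?thesis
      using sum.remove[OF finite_set j, of "\<lambda>i. defect_sum i (count_list (j # w) i) x"] by simp
  qed
  finally show ?case .
qed simp

lemma defect_sum_convergent:
  assumes i: "i \<in> I"
  shows "convergent (\<lambda>k. defect_sum i k x)"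
proof -
  have pyth: "(norm (y - (V i ^^ d) ((V' i ^^ d) y)))\<^sup>2 = (norm y)\<^sup>2 - (norm ((V' i ^^ d) y))\<^sup>2" for d y
  proof -
    define u where "u = (V i ^^ d) ((V' i ^^ d) y)"
    have "inner u y = (norm ((V' i ^^ d) y))\<^sup>2"
      by (simp add: u_def V_funpow_adjoint[OF i] power2_norm_eq_inner)
    moreover have "inner u u = (norm ((V' i ^^ d) y))\<^sup>2"
      using norm_V_funpow[OF i] by (simp add: u_def power2_norm_eq_inner[symmetric])
    ultimately show ?thesis
      by (simp add: u_def[symmetric] power2_norm_eq_inner inner_diff_left inner_diff_right inner_commute[of y u])
  qed
  let ?a = "\<lambda>k. (norm ((V' i ^^ k) x))\<^sup>2"
  have dist: "(norm (defect_sum i (k + d) x - defect_sum i k x))\<^sup>2 = ?a k - ?a (k + d)" for k d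
  proof -
    let ?y = "(V' i ^^ k) x"
    have V': "(V' i ^^ (k + d)) x = (V' i ^^ d) ?y"
      by (simp add: funpow_add[of d k, unfolded add.commute[of d k]])
    have "defect_sum i (k + d) x - defect_sum i k x =
        (V i ^^ k) ?y - (V i ^^ k) ((V i ^^ d) ((V' i ^^ d) ?y))"
      unfolding defect_sum_def V' funpow_add[of k d "V i"] by simp
    also have "\<dots> = (V i ^^ k) (?y - (V i ^^ d) ((V' i ^^ d) ?y))"
      by (rule linear_diff[OF bounded_linear.linear[OF bounded_clinearD(1)[OF V_funpow_clinear[OF i]]], symmetric])
    finally show ?thesis unfolding V' by (simp only: norm_V_funpow[OF i] pyth)
  qed
  have "decseq ?a"
    by (rule decseq_SucI) (auto intro!: power_mono norm_V'_le[OF i])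
  then obtain l where "?a \<longlonglongrightarrow> l" using decseq_convergent[of ?a 0] by auto
  then have "Cauchy ?a" by (rule LIMSEQ_imp_Cauchy)
  have "Cauchy (\<lambda>k. defect_sum i k x)"
  proof (rule CauchyI)
    fix e :: real assume e: "0 < e"
    then obtain K where K: "\<And>m n. m \<ge> K \<Longrightarrow> n \<ge> K \<Longrightarrow> norm (?a m - ?a n) < e\<^sup>2"
      using CauchyD[OF \<open>Cauchy ?a\<close>, of "e\<^sup>2"] by auto
    have *: "norm (defect_sum i m x - defect_sum i n x) < e" if "K \<le> n" "n \<le> m" for m n
    proof -
      obtain d where m: "m = n + d" using \<open>n \<le> m\<close> le_Suc_ex by blast
      have "(norm (defect_sum i m x - defect_sum i n x))\<^sup>2 < e\<^sup>2"
        using dist[of n d] K[of n m] that by (simp add: m)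
      then show ?thesis using e by (meson less_imp_le power_less_imp_less_base)
    qed
    show "\<exists>K. \<forall>m\<ge>K. \<forall>n\<ge>K. norm (defect_sum i m x - defect_sum i n x) < e"
      using * by (metis nle_le norm_minus_commute)
  qed
  then show ?thesis by (rule Cauchy_convergent)
qed

text \<open>\<open>P i\<close> is the projection to the shift part of \<open>V i\<close> in its Wold decomposition; the other \<open>V j\<close>
  act on its range as unitaries.\<close>

definition P :: "'i \<Rightarrow> 'k \<Rightarrow> 'k" where
  "P i x = lim (\<lambda>k. defect_sum i k x)"

lemma P_tendsto: "i \<in> I \<Longrightarrow> (\<lambda>k. defect_sum i k x) \<longlonglongrightarrow> P i x"
  unfolding P_def using defect_sum_convergent convergent_LIMSEQ_iff by blast

lemma P_eqI: "i \<in> I \<Longrightarrow> (\<lambda>k. defect_sum i k x) \<longlonglongrightarrow> y \<Longrightarrow> P i x = y"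
  using P_tendsto LIMSEQ_unique by blast

lemma P_map:
  assumes i: "i \<in> I" and A: "bounded_linear A" and "\<And>k. defect_sum i k y = A (defect_sum i k x)"
  shows "P i y = A (P i x)"
  by (rule P_eqI[OF i]) (simp add: assms bounded_linear.tendsto[OF A P_tendsto[OF i]])

lemma P_add: "i \<in> I \<Longrightarrow> P i (x + y) = P i x + P i y"
  by (rule P_eqI) (simp_all add: linear_add[OF bounded_linear.linear[OF bounded_clinearD(1)[OF defect_sum_clinear]]]
      tendsto_add P_tendsto)

lemma P_scaleC: "i \<in> I \<Longrightarrow> P i (c *\<^sub>C x) = c *\<^sub>C P i x"
  by (rule P_map[OF _ bounded_linear_scaleC]) (simp_all add: bounded_clinearD(2)[OF defect_sum_clinear])

lemma P_adjoint:
  assumes i: "i \<in> I"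
  shows "inner (P i x) y = inner x (P i y)"
proof -
  have "inner (defect_sum i k x) y = inner x (defect_sum i k y)" for k
    using V_funpow_adjoint[OF i, of k "(V' i ^^ k) x" y] V_funpow_adjoint[OF i, of k "(V' i ^^ k) y" x]
    by (simp add: defect_sum_def inner_diff_left inner_diff_right inner_commute)
  moreover have "(\<lambda>k. inner (defect_sum i k x) y) \<longlonglongrightarrow> inner (P i x) y"
    and "(\<lambda>k. inner x (defect_sum i k y)) \<longlonglongrightarrow> inner x (P i y)"
    by (intro tendsto_intros P_tendsto[OF i])+
  ultimately show ?thesis by (simp add: LIMSEQ_unique)
qed

lemma P_V':
  assumes i: "i \<in> I" and j: "j \<in> I" and ij: "i \<noteq> j"
  shows "P i (V' j x) = V' j (P i x)" "V j (V' j (P i x)) = P i x"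
proof -
  have *: "P i x = V j (P i (V' j x))"
    by (rule P_map[OF i V_bounded_linear[OF j]]) (simp add: defect_sum_conj[OF i j ij])
  then show "P i (V' j x) = V' j (P i x)" by (metis V'_V[OF j])
  with * show "V j (V' j (P i x)) = P i x" by simp
qed

lemma P_V:
  assumes i: "i \<in> I" and j: "j \<in> I"
  shows "P i (V j x) = V j (P i x)"
proof (cases "i = j")
  case True
  have "(\<lambda>k. defect_sum i (Suc k) (V i x)) \<longlonglongrightarrow> V i (P i x)"
    using bounded_linear.tendsto[OF V_bounded_linear[OF i] P_tendsto[OF i]]
    by (simp add: defect_sum_Suc[OF i] V'_V[OF i])
  then have "(\<lambda>k. defect_sum i k (V i x)) \<longlonglongrightarrow> V i (P i x)"
    by (rule iffD1[OF filterlim_sequentially_Suc])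
  then show ?thesis using P_eqI[OF i] True by simp
next
  case False
  have "P i (V j x) = V j (P i (V' j (V j x)))"
    by (rule P_map[OF i V_bounded_linear[OF j]]) (simp only: defect_sum_conj[OF i j False])
  then show ?thesis by (simp add: V'_V[OF j])
qed

lemma P_V'_all:
  assumes i: "i \<in> I" and j: "j \<in> I"
  shows "P i (V' j x) = V' j (P i x)"
  by (rule inner_eqI) (metis P_V[OF i j] V_adjoint[OF j] P_adjoint[OF i] inner_commute)

lemma fold_V'_power: "fold V' (concat (replicate k w)) x = (fold V' w ^^ k) x"
  by (induction k arbitrary: x) (simp_all add: funpow_swap1)

lemma count_list_concat_replicate: "count_list (concat (replicate k w)) i = k * count_list w i"
  by (induction k) simp_all

lemma count_list_distinct: "distinct w \<Longrightarrow> count_list w i = (if i \<in> set w then 1 else 0)"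
  by (induction w) auto

lemma sum_P: "(\<Sum>i\<in>I. P i x) = x"
proof -
  let ?w = "\<lambda>k. concat (replicate k idx)"
  have sub: "set (?w k) \<subseteq> I" for k by (induction k) auto
  have "(\<lambda>k. foldr V (?w k) (fold V' (?w k) x)) \<longlonglongrightarrow> 0"
    using pure[of x] by (subst tendsto_norm_zero_iff[symmetric])
      (simp add: norm_foldr_V[OF sub] fold_V'_power tendsto_norm_zero)
  then have "(\<lambda>k. x - foldr V (?w k) (fold V' (?w k) x)) \<longlonglongrightarrow> x - 0" by (intro tendsto_intros)
  moreover have "x - foldr V (?w k) (fold V' (?w k) x) = (\<Sum>i\<in>I. defect_sum i k x)" for k
    by (simp add: word_defect[OF sub] count_list_concat_replicate count_list_distinct[OF distinct_idx])
  moreover have "(\<lambda>k. \<Sum>i\<in>I. defect_sum i k x) \<longlonglongrightarrow> (\<Sum>i\<in>I. P i x)"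
    by (intro tendsto_sum P_tendsto)
  ultimately show ?thesis by (simp add: LIMSEQ_unique)
qed

lemma P_orthogonal:
  assumes i: "i \<in> I" and l: "l \<in> I" and "i \<noteq> l"
  shows "P l (P i x) = 0"
proof -
  have "(V l ^^ k) ((V' l ^^ k) (P i x)) = P i x" for k
  proof (induction k arbitrary: x)
    case (Suc k)
    have "(V l ^^ Suc k) ((V' l ^^ Suc k) (P i x)) = V l ((V l ^^ k) ((V' l ^^ k) (V' l (P i x))))"
      by (simp only: funpow.simps(2) comp_apply funpow_swap1[of "V' l"])
    also have "\<dots> = V l ((V l ^^ k) ((V' l ^^ k) (P i (V' l x))))" by (simp only: P_V'(1)[OF assms])
    also have "\<dots> = V l (V' l (P i x))" unfolding Suc by (simp only: P_V'(1)[OF assms])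
    finally show ?case by (simp only: P_V'(2)[OF assms])
  qed simp
  then show ?thesis by (intro P_eqI[OF l]) (simp add: defect_sum_def)
qed

lemma P_idem: "i \<in> I \<Longrightarrow> P i (P i x) = P i x"
proof -
  assume i: "i \<in> I"
  have "(\<Sum>l\<in>I-{i}. P l (P i x)) = 0" by (rule sum.neutral) (use P_orthogonal[OF i] in auto)
  then show ?thesis using sum_P[of "P i x"] sum.remove[OF finite_set i, of "\<lambda>l. P l (P i x)"] by simp
qed

lemma P_norm_limit:
  assumes i: "i \<in> I"
  shows "\<exists>w. (\<forall>k. set (w k) \<subseteq> I) \<and> (\<forall>x. (\<lambda>k. norm (fold V' (w k) x)) \<longlonglongrightarrow> norm (P i x))"
proof -
  define w where "w k = concat (replicate k (remove1 i idx))" for k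
  have sub: "set (w k) \<subseteq> I" for k
    using set_remove1_subset[of i idx] by (auto simp: w_def set_replicate_conv_if)
  have cnt: "count_list (w k) l = (if l = i then 0 else k)" if "l \<in> I" for k l
    using that distinct_idx by (simp add: w_def count_list_concat_replicate count_list_distinct set_remove1_eq)
  have lim: "(\<lambda>k. norm (fold V' (w k) x)) \<longlonglongrightarrow> norm (P i x)" for x
  proof -
    have "x - foldr V (w k) (fold V' (w k) x) = (\<Sum>l\<in>I-{i}. defect_sum l k x)" for k
      using i by (simp add: word_defect[OF sub] sum.remove[OF _ i] cnt)
    then have eq: "foldr V (w k) (fold V' (w k) x) = x - (\<Sum>l\<in>I-{i}. defect_sum l k x)" for k
      by (metis diff_diff_eq2 add_diff_cancel_left')
    have "(\<lambda>k. x - (\<Sum>l\<in>I-{i}. defect_sum l k x)) \<longlonglongrightarrow> x - (\<Sum>l\<in>I-{i}. P l x)"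
      by (intro tendsto_intros P_tendsto) auto
    also have "x - (\<Sum>l\<in>I-{i}. P l x) = P i x"
      using sum_P[of x] sum.remove[of I i "\<lambda>l. P l x"] i by (simp add: algebra_simps)
    finally have "(\<lambda>k. norm (foldr V (w k) (fold V' (w k) x))) \<longlonglongrightarrow> norm (P i x)"
      unfolding eq by (rule tendsto_norm)
    then show ?thesis by (simp add: norm_foldr_V[OF sub])
  qed
  show ?thesis using sub lim by blast
qed

lemma norm_sum_P: "(norm (\<Sum>i\<in>I. P i (y i)))\<^sup>2 = (\<Sum>i\<in>I. (norm (P i (y i)))\<^sup>2)"
proof -
  have "inner (P i (y i)) (\<Sum>l\<in>I. P l (y l)) = (norm (P i (y i)))\<^sup>2" if i: "i \<in> I" for i
  proof -
    have "inner (P i (y i)) (P l (y l)) = 0" if "l \<in> I - {i}" for l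
      using that i P_orthogonal[of l i "y l"] by (simp add: P_adjoint[OF i])
    then have "(\<Sum>l\<in>I-{i}. inner (P i (y i)) (P l (y l))) = 0" by (rule sum.neutral[OF ballI])
    then show ?thesis
      using sum.remove[OF finite_set i, of "\<lambda>l. inner (P i (y i)) (P l (y l))"]
      by (simp add: inner_sum_right power2_norm_eq_inner)
  qed
  then show ?thesis by (simp add: power2_norm_eq_inner[of "sum _ _"] inner_sum_left)
qed

lemma P_bounded_linear:
  assumes i: "i \<in> I"
  shows "bounded_linear (P i)"
proof (rule bounded_linear_intro[where K = 1])
  show "P i (r *\<^sub>R x) = r *\<^sub>R P i x" for r x
    by (simp add: scaleR_scaleC P_scaleC[OF i])
  have "(norm (P i x))\<^sup>2 \<le> (norm x)\<^sup>2" for x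
    using norm_sum_P[of "\<lambda>_. x"] member_le_sum[of i I "\<lambda>i. (norm (P i x))\<^sup>2"] i by (simp add: sum_P)
  then show "norm (P i x) \<le> norm x * 1" for x using power2_le_imp_le[of "norm (P i x)" "norm x"] by simp
qed (rule P_add[OF i])

end

section \<open>Lifting intertwiners\<close>

locale dilated_intertwiner = pure_isometric_tuple idx V V'
  for idx :: "'i list" and V V' :: "'i \<Rightarrow> 'k::chilbert_space \<Rightarrow> 'k" +
  fixes T' :: "'i \<Rightarrow> 'h::chilbert_space \<Rightarrow> 'h" and \<pi> :: "'h \<Rightarrow> 'k" and Z :: "'h \<Rightarrow> 'h" and c :: real
  assumes \<pi>_clinear: "bounded_clinear \<pi>" and norm_\<pi>: "norm (\<pi> h) = norm h"
    and \<pi>_T': "i \<in> set idx \<Longrightarrow> \<pi> (T' i h) = V' i (\<pi> h)"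
    and Z_clinear: "bounded_clinear Z" and Z_bound: "norm (Z h) \<le> c * norm h" and c_nonneg: "0 \<le> c"
    and Z_T': "i \<in> set idx \<Longrightarrow> Z (T' i h) = T' i (Z h)"
begin

lemma \<pi>_fold: "set w \<subseteq> I \<Longrightarrow> \<pi> (fold T' w h) = fold V' w (\<pi> h)"
  by (induction w arbitrary: h) (simp_all add: \<pi>_T')

lemma Z_fold: "set w \<subseteq> I \<Longrightarrow> Z (fold T' w h) = fold T' w (Z h)"
  by (induction w arbitrary: h) (simp_all add: Z_T')

lemma P_\<pi>_Z_bound:
  assumes i: "i \<in> I"
  shows "norm (P i (\<pi> (Z h))) \<le> c * norm (P i (\<pi> h))"
proof -
  obtain w where w: "\<And>k. set (w k) \<subseteq> I"
    and lim: "\<And>x. (\<lambda>k. norm (fold V' (w k) x)) \<longlonglongrightarrow> norm (P i x)"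
    using P_norm_limit[OF i] by blast
  have "norm (fold V' (w k) (\<pi> (Z h))) \<le> c * norm (fold V' (w k) (\<pi> h))" for k
    using Z_bound[of "fold T' (w k) h"] by (simp add: \<pi>_fold[OF w, symmetric] norm_\<pi> Z_fold[OF w])
  then show ?thesis by (intro LIMSEQ_le[OF lim tendsto_mult[OF tendsto_const lim]]) auto
qed

text \<open>The operator \<open>P i (\<pi> h) \<mapsto> P i (\<pi> (Z h))\<close>, extended along the unitaries \<open>V j\<close> with \<open>j \<noteq> i\<close>, as a
  linear relation.\<close>

definition graph :: "'i \<Rightarrow> 'k \<Rightarrow> 'k \<Rightarrow> bool" where
  "graph i x z \<longleftrightarrow> P i x = x \<and> (\<exists>w h. set w \<subseteq> I - {i} \<and>
     fold V' w x = P i (\<pi> h) \<and> z = foldr V w (P i (\<pi> (Z h))))"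

lemma graphI:
  "P i x = x \<Longrightarrow> set w \<subseteq> I - {i} \<Longrightarrow> fold V' w x = P i (\<pi> h) \<Longrightarrow>
   z = foldr V w (P i (\<pi> (Z h))) \<Longrightarrow> graph i x z"
  unfolding graph_def by blast

lemma P_foldr_V: "i \<in> I \<Longrightarrow> set w \<subseteq> I \<Longrightarrow> P i (foldr V w x) = foldr V w (P i x)"
  by (induction w) (simp_all add: P_V)

lemma P_fold_V': "i \<in> I \<Longrightarrow> set w \<subseteq> I \<Longrightarrow> P i (fold V' w x) = fold V' w (P i x)"
  by (induction w arbitrary: x) (simp_all add: P_V'_all)

lemma V_V'_on_range: "i \<in> I \<Longrightarrow> j \<in> I - {i} \<Longrightarrow> P i y = y \<Longrightarrow> V j (V' j y) = y"
  using P_V'(2)[of i j y] by auto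

lemma V'_V_commute:
  assumes i: "i \<in> I" and l: "l \<in> I - {i}" and j: "j \<in> I" and y: "P i y = y"
  shows "V l (V' j y) = V' j (V l y)"
proof (cases "j = l")
  case True
  then show ?thesis using V_V'_on_range[OF i l y] V'_V[of l y] l by simp
next
  case False
  have "P i (V' j (V l y)) = V' j (V l y)" using l by (simp add: P_V'_all[OF i j] P_V[OF i] y)
  then have "V' j (V l y) = V l (V' l (V' j (V l y)))" using V_V'_on_range[OF i l] by simp
  also have "\<dots> = V l (V' j (V' l (V l y)))" using V'_commute[OF j] l by simp
  finally show ?thesis using V'_V[of l y] l by simp
qed

lemma V'_V_commute':
  assumes i: "i \<in> I" and j: "j \<in> I - {i}" and y: "P i y = y"
  shows "V' j (V i y) = V i (V' j y)"
proof -
  have jI: "j \<in> I" using j by simp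
  have "V' j (V i y) = V' j (V i (V j (V' j y)))" by (simp only: V_V'_on_range[OF i j y])
  also have "\<dots> = V i (V' j y)" by (simp only: V_commute[OF i jI] V'_V[OF jI])
  finally show ?thesis .
qed

lemma foldr_V_V'_commute:
  assumes i: "i \<in> I" and w: "set w \<subseteq> I - {i}" and j: "j \<in> I" and y: "P i y = y"
  shows "foldr V w (V' j y) = V' j (foldr V w y)"
  using w
proof (induction w)
  case (Cons l w)
  then have "P i (foldr V w y) = foldr V w y" using i y by (subst P_foldr_V) auto
  with Cons show ?case using V'_V_commute[OF i _ j] by simp
qed simp

lemma foldr_fold_on_range:
  assumes i: "i \<in> I" and w: "set w \<subseteq> I - {i}" and y: "P i y = y"
  shows "foldr V w (fold V' w y) = y"
  using w y
proof (induction w arbitrary: y)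
  case (Cons l w)
  then have "P i (V' l y) = V' l y" using i by (simp add: P_V'_all)
  then show ?case using Cons V_V'_on_range[OF i] by simp
qed simp

lemma graph_extend:
  assumes i: "i \<in> I" and w: "set w \<subseteq> I - {i}" and u: "set u \<subseteq> I - {i}"
    and x: "fold V' w x = P i (\<pi> h)" and z: "z = foldr V w (P i (\<pi> (Z h)))"
  shows "fold V' (w @ u) x = P i (\<pi> (fold T' u h))"
    and "z = foldr V (w @ u) (P i (\<pi> (Z (fold T' u h))))"
proof -
  have uI: "set u \<subseteq> I" using u by auto
  show "fold V' (w @ u) x = P i (\<pi> (fold T' u h))"
    by (simp add: x \<pi>_fold[OF uI] P_fold_V'[OF i uI])
  show "z = foldr V (w @ u) (P i (\<pi> (Z (fold T' u h))))"
    by (simp add: z Z_fold[OF uI] \<pi>_fold[OF uI] P_fold_V'[OF i uI] foldr_fold_on_range[OF i u P_idem[OF i]])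
qed

lemmas \<pi>_linear = bounded_linear.linear[OF bounded_clinearD(1)[OF \<pi>_clinear]]
  and Z_linear = bounded_linear.linear[OF bounded_clinearD(1)[OF Z_clinear]]

lemma graph_add:
  assumes i: "i \<in> I" and "graph i x z" "graph i x' z'"
  shows "graph i (x + x') (z + z')"
proof -
  obtain w h where w: "P i x = x" "set w \<subseteq> I - {i}" "fold V' w x = P i (\<pi> h)" "z = foldr V w (P i (\<pi> (Z h)))"
    using assms(2) unfolding graph_def by blast
  obtain u k where u: "P i x' = x'" "set u \<subseteq> I - {i}" "fold V' u x' = P i (\<pi> k)" "z' = foldr V u (P i (\<pi> (Z k)))"
    using assms(3) unfolding graph_def by blast
  have wu: "set w \<subseteq> I" "set u \<subseteq> I" "set (w @ u) \<subseteq> I" using w(2) u(2) by auto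
  note f = linear_add[OF bounded_linear.linear[OF bounded_clinearD(1)[OF fold_V'_linear[OF wu(3)]]]]
    linear_add[OF bounded_linear.linear[OF bounded_clinearD(1)[OF foldr_V_linear[OF wu(3)]]]]
  note e = graph_extend[OF i w(2) u(2) w(3,4)]
    graph_extend[OF i u(2) w(2) u(3,4), unfolded fold_V'_append_commute[OF wu(2,1)] foldr_V_append_commute[OF wu(2,1)]]
  show ?thesis
  proof (rule graphI[where w = "w @ u" and h = "fold T' u h + fold T' w k"])
    show "P i (x + x') = x + x'" using w u by (simp add: P_add[OF i])
    show "fold V' (w @ u) (x + x') = P i (\<pi> (fold T' u h + fold T' w k))"
      unfolding f e linear_add[OF \<pi>_linear] P_add[OF i] ..
    show "z + z' = foldr V (w @ u) (P i (\<pi> (Z (fold T' u h + fold T' w k))))"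
      unfolding linear_add[OF \<pi>_linear] linear_add[OF Z_linear] P_add[OF i] f
      using e by simp
  qed (use w u in auto)
qed

lemma graph_scaleC:
  assumes i: "i \<in> I" and "graph i x z"
  shows "graph i (d *\<^sub>C x) (d *\<^sub>C z)"
proof -
  obtain w h where w: "P i x = x" "set w \<subseteq> I - {i}" "fold V' w x = P i (\<pi> h)" "z = foldr V w (P i (\<pi> (Z h)))"
    using assms(2) unfolding graph_def by blast
  have wI: "set w \<subseteq> I" using w(2) by auto
  show ?thesis
    by (rule graphI[OF _ w(2), where h = "d *\<^sub>C h"])
       (simp_all add: P_scaleC[OF i] w(1,3,4) bounded_clinearD(2)[OF \<pi>_clinear] bounded_clinearD(2)[OF Z_clinear]
         bounded_clinearD(2)[OF fold_V'_linear[OF wI]] bounded_clinearD(2)[OF foldr_V_linear[OF wI]])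
qed

lemma graph_bound:
  assumes i: "i \<in> I" and "graph i x z"
  shows "norm z \<le> c * norm x"
proof -
  obtain w h where w: "P i x = x" "set w \<subseteq> I - {i}" "fold V' w x = P i (\<pi> h)" "z = foldr V w (P i (\<pi> (Z h)))"
    using assms(2) unfolding graph_def by blast
  have wI: "set w \<subseteq> I" using w(2) by auto
  have "norm z \<le> c * norm (fold V' w x)"
    using P_\<pi>_Z_bound[OF i, of h] by (simp add: w(4) norm_foldr_V[OF wI] w(3))
  also have "\<dots> \<le> c * norm x" by (rule mult_left_mono[OF norm_fold_V'_le[OF wI] c_nonneg])
  finally show ?thesis .
qed

lemma graph_V':
  assumes i: "i \<in> I" and j: "j \<in> I" and "graph i x z"
  shows "graph i (V' j x) (V' j z)"
proof -
  obtain w h where w: "P i x = x" "set w \<subseteq> I - {i}" "fold V' w x = P i (\<pi> h)" "z = foldr V w (P i (\<pi> (Z h)))"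
    using assms(3) unfolding graph_def by blast
  have wI: "set w \<subseteq> I" using w(2) by auto
  show ?thesis
  proof (rule graphI[OF _ w(2), where h = "T' j h"])
    show "P i (V' j x) = V' j x" by (simp add: P_V'_all[OF i j] w(1))
    show "fold V' w (V' j x) = P i (\<pi> (T' j h))"
      by (simp add: fold_V'_commute[OF wI j] w(3) \<pi>_T'[OF j] P_V'_all[OF i j])
    show "V' j z = foldr V w (P i (\<pi> (Z (T' j h))))"
      by (simp add: w(4) Z_T'[OF j] \<pi>_T'[OF j] P_V'_all[OF i j] foldr_V_V'_commute[OF i w(2) j P_idem[OF i]])
  qed
qed

lemma graph_V:
  assumes i: "i \<in> I" and j: "j \<in> I - {i}" and "graph i x z"
  shows "graph i (V j x) (V j z)"
proof -
  obtain w h where w: "P i x = x" "set w \<subseteq> I - {i}" "fold V' w x = P i (\<pi> h)" "z = foldr V w (P i (\<pi> (Z h)))"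
    using assms(3) unfolding graph_def by blast
  show ?thesis
    by (rule graphI[where w = "j # w" and h = h]) (use w j P_V[OF i, of j x] V'_V[of j x] in auto)
qed

lemma graph_P:
  assumes i: "i \<in> I" and "graph i x z"
  shows "P i x = x" "P i z = z"
proof -
  obtain w h where w: "P i x = x" "set w \<subseteq> I - {i}" "z = foldr V w (P i (\<pi> (Z h)))"
    using assms(2) unfolding graph_def by blast
  have wI: "set w \<subseteq> I" using w(2) by auto
  show "P i x = x" by (rule w(1))
  show "P i z = z" by (simp add: w(3) P_foldr_V[OF i wI] P_idem[OF i])
qed

lemma graph_unique:
  assumes i: "i \<in> I" and "graph i x z" "graph i x z'"
  shows "z = z'"
proof -
  have "graph i (x + (-1) *\<^sub>C x) (z + (-1) *\<^sub>C z')"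
    by (intro graph_add graph_scaleC assms)
  from graph_bound[OF i this] show ?thesis by (simp add: scaleC_minus1)
qed

lemma graph_0: "i \<in> I \<Longrightarrow> graph i 0 0"
  by (rule graphI[where w = "[]" and h = 0])
     (simp_all add: linear_0[OF \<pi>_linear] linear_0[OF Z_linear] linear_0[OF bounded_linear.linear[OF P_bounded_linear]])

definition symmetries :: "'i \<Rightarrow> ('k \<Rightarrow> 'k) set" where
  "symmetries i = {\<lambda>x. d *\<^sub>C x | d. True} \<union> {P i} \<union> {\<lambda>x. V j (P i x) | j. j \<in> I - {i}} \<union>
     {\<lambda>x. V' j (P i x) | j. j \<in> I - {i}}"

lemma symmetries_cases [consumes 1, case_names scaleC P V V']:
  assumes "A \<in> symmetries i"
  obtains d where "A = (\<lambda>x. d *\<^sub>C x)" | "A = P i"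
    | j where "j \<in> I - {i}" "A = (\<lambda>x. V j (P i x))"
    | j where "j \<in> I - {i}" "A = (\<lambda>x. V' j (P i x))"
  using assms unfolding symmetries_def by blast

lemma symmetriesI:
  "(\<lambda>x. d *\<^sub>C x) \<in> symmetries i" "P i \<in> symmetries i"
  "j \<in> I \<Longrightarrow> j \<noteq> i \<Longrightarrow> (\<lambda>x. V j (P i x)) \<in> symmetries i"
  "j \<in> I \<Longrightarrow> j \<noteq> i \<Longrightarrow> (\<lambda>x. V' j (P i x)) \<in> symmetries i"
  unfolding symmetries_def by blast+

lemma commutant_lifting_symmetries:
  assumes i: "i \<in> I"
  shows "commutant_lifting (V i) (V' i) (P i) (symmetries i) c"
proof (rule commutant_lifting.intro)
  show "bounded_linear (V i)" "bounded_linear (V' i)"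
    by (rule V_bounded_linear[OF i], rule V'_bounded_linear[OF i])
  show "inner (V i x) y = inner x (V' i y)" for x y by (rule V_adjoint[OF i])
  show "V' i (V i x) = x" for x by (rule V'_V[OF i])
  show "0 \<le> c" by (rule c_nonneg)
  show "P i \<in> symmetries i" by (rule symmetriesI)
  fix A assume "A \<in> symmetries i"
  then show "bounded_linear A"
    by (cases rule: symmetries_cases)
       (auto intro!: bounded_linear_scaleC P_bounded_linear[OF i]
         bounded_linear_compose[OF V_bounded_linear P_bounded_linear[OF i]]
         bounded_linear_compose[OF V'_bounded_linear P_bounded_linear[OF i]])
next
  fix A x assume "A \<in> symmetries i"
  then show "A (V i x) = V i (A x)"
    by (cases rule: symmetries_cases)
       (auto simp: bounded_clinearD(2)[OF V_clinear[OF i]] P_V[OF i i] V_commute[OF _ i] P_idem[OF i]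
         V'_V_commute'[OF i])
next
  fix A x assume "A \<in> symmetries i"
  then show "A (V' i x) = V' i (A x)"
    by (cases rule: symmetries_cases)
       (auto simp: bounded_clinearD(2)[OF V'_clinear[OF i]] P_V'_all[OF i i] V'_commute[OF _ i] P_idem[OF i]
         V'_V_commute[OF i _ i])
next
  fix A assume "A \<in> symmetries i"
  then show "\<exists>A'\<in>symmetries i. \<forall>x y. inner (A x) y = inner x (A' y)"
  proof (cases rule: symmetries_cases)
    case (scaleC d)
    show ?thesis
      by (rule bexI[OF _ symmetriesI(1)[of "cnj d"]]) (simp add: scaleC inner_scaleC_left)
  next
    case P
    show ?thesis by (rule bexI[OF _ symmetriesI(2)]) (simp add: P P_adjoint[OF i])
  next
    case (V j)
    then show ?thesis
      by (intro bexI[OF _ symmetriesI(4)[of j]]) (auto simp: V_adjoint P_adjoint[OF i] P_V'_all[OF i])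
  next
    case (V' j)
    then have "inner (V' j (P i x)) y = inner x (V j (P i y))" for x y
      using V_adjoint[of j y "P i x"] by (simp add: inner_commute P_adjoint[OF i, symmetric] P_V[OF i])
    then show ?thesis using V' by (intro bexI[OF _ symmetriesI(3)[of j]]) auto
  qed
next
  fix A assume "A \<in> symmetries i"
  then show "\<exists>r. \<forall>x. P i x = x \<longrightarrow> (norm (A x))\<^sup>2 = r * (norm x)\<^sup>2"
  proof (cases rule: symmetries_cases)
    case (scaleC d)
    then show ?thesis by (intro exI[of _ "(cmod d)\<^sup>2"]) (simp add: norm_scaleC power_mult_distrib)
  next
    case P
    then show ?thesis by (intro exI[of _ 1]) simp
  next
    case (V j)
    then show ?thesis by (intro exI[of _ 1]) (simp add: norm_V)
  next
    case (V' j)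
    then have "norm (V' j x) = norm x" if "P i x = x" for x
      using norm_V[of j "V' j x"] V_V'_on_range[OF i V'(1) that] by simp
    then show ?thesis using V' by (intro exI[of _ 1]) simp
  qed
qed

lemma component_lift:
  assumes i: "i \<in> I"
  shows "\<exists>G. bounded_linear G \<and> (\<forall>x. norm (G x) \<le> c * norm x) \<and>
    (\<forall>h. G (P i (\<pi> h)) = P i (\<pi> (Z h))) \<and> (\<forall>x. G (V' i x) = V' i (G x)) \<and>
    (\<forall>A\<in>symmetries i. \<forall>x. G (A x) = A (G x))"
proof -
  interpret commutant_lifting "V i" "V' i" "P i" "symmetries i" c
    by (rule commutant_lifting_symmetries[OF i])
  define N where "N = {x. \<exists>z. graph i x z}"
  define G0 where "G0 x = (THE z. graph i x z)" for x
  have G0: "G0 x = z" if "graph i x z" for x z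
    unfolding G0_def using that graph_unique[OF i] by blast
  have N: "x \<in> N" if "graph i x z" for x z using that by (auto simp: N_def)
  have graph: "graph i x (G0 x)" if "x \<in> N" for x
    using that G0 by (auto simp: N_def)
  have add: "graph i (x + y) (G0 x + G0 y)" if "x \<in> N" "y \<in> N" for x y
    by (rule graph_add[OF i graph[OF that(1)] graph[OF that(2)]])
  have scale: "graph i (d *\<^sub>C x) (d *\<^sub>C G0 x)" if "x \<in> N" for d x
    by (rule graph_scaleC[OF i graph[OF that]])
  have gV': "graph i (V' j x) (V' j (G0 x))" if "j \<in> I" "x \<in> N" for j x
    by (rule graph_V'[OF i that(1) graph[OF that(2)]])
  have sym: "graph i (A x) (A (G0 x))" if A: "A \<in> symmetries i" and x: "x \<in> N" for A x
    using A
  proof (cases rule: symmetries_cases)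
    case (scaleC d)
    then show ?thesis using scale[OF x] by simp
  next
    case P
    then show ?thesis using graph[OF x] graph_P[OF i graph[OF x]] by simp
  next
    case (V j)
    then show ?thesis using graph_V[OF i V(1) graph[OF x]] graph_P[OF i graph[OF x]] by simp
  next
    case (V' j)
    then show ?thesis using gV'[of j x] x graph_P[OF i graph[OF x]] by simp
  qed
  have "partial_lift N G0"
    unfolding partial_lift_def
  proof (intro conjI ballI)
    show "subspace N"
      unfolding subspace_def scaleR_scaleC
      using N[OF graph_0[OF i]] N[OF add] N[OF scale] by simp
    show "linear_map_on N G0"
      unfolding linear_map_on_def scaleR_scaleC
      using G0[OF add] G0[OF scale] by simp
    fix x assume x: "x \<in> N"
    show "V' i x \<in> N" "G0 (V' i x) = V' i (G0 x)" using N[OF gV'[OF i x]] G0[OF gV'[OF i x]] .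
    show "P i x = x" by (rule graph_P[OF i graph[OF x]])
    show "norm (G0 x) \<le> c * norm x" by (rule graph_bound[OF i graph[OF x]])
  next
    fix A x assume Ax: "A \<in> symmetries i" "x \<in> N"
    show "A x \<in> N" "G0 (A x) = A (G0 x)" using N[OF sym[OF Ax]] G0[OF sym[OF Ax]] .
  qed
  from commutant_lift[OF this] obtain G where G: "bounded_linear G" "\<forall>x. norm (G x) \<le> c * norm x" "\<forall>x\<in>N. G x = G0 x"
    "\<forall>x. G (V' i x) = V' i (G x)" "\<forall>A\<in>symmetries i. \<forall>x. G (A x) = A (G x)"
    by (elim exE conjE)
  have "G (P i (\<pi> h)) = P i (\<pi> (Z h))" for h
  proof -
    have "graph i (P i (\<pi> h)) (P i (\<pi> (Z h)))"
      by (rule graphI[where w = "[]" and h = h]) (simp_all add: P_idem[OF i])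
    from bspec[OF G(3) N[OF this]] G0[OF this] show ?thesis by (rule trans)
  qed
  then have "\<forall>h. G (P i (\<pi> h)) = P i (\<pi> (Z h))" ..
  with G show ?thesis by (intro exI[of _ G] conjI)
qed

theorem intertwining_lift:
  "\<exists>G. bounded_clinear G \<and> (\<forall>x. norm (G x) \<le> c * norm x) \<and> (\<forall>h. G (\<pi> h) = \<pi> (Z h)) \<and>
    (\<forall>j\<in>I. \<forall>x. G (V' j x) = V' j (G x))"
proof -
  have "\<forall>i\<in>I. \<exists>G. bounded_linear G \<and> (\<forall>x. norm (G x) \<le> c * norm x) \<and>
    (\<forall>h. G (P i (\<pi> h)) = P i (\<pi> (Z h))) \<and> (\<forall>x. G (V' i x) = V' i (G x)) \<and>
    (\<forall>A\<in>symmetries i. \<forall>x. G (A x) = A (G x))"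
    by (rule ballI, rule component_lift)
  from bchoice[OF this] obtain g where all: "\<forall>i\<in>I. bounded_linear (g i) \<and>
    (\<forall>x. norm (g i x) \<le> c * norm x) \<and> (\<forall>h. g i (P i (\<pi> h)) = P i (\<pi> (Z h))) \<and>
    (\<forall>x. g i (V' i x) = V' i (g i x)) \<and> (\<forall>A\<in>symmetries i. \<forall>x. g i (A x) = A (g i x))"
    by (elim exE)
  have g: "\<And>i. i \<in> I \<Longrightarrow> bounded_linear (g i)"
    and g_bound: "\<And>i x. i \<in> I \<Longrightarrow> norm (g i x) \<le> c * norm x"
    and g_\<pi>: "\<And>i h. i \<in> I \<Longrightarrow> g i (P i (\<pi> h)) = P i (\<pi> (Z h))"
    and g_V': "\<And>i x. i \<in> I \<Longrightarrow> g i (V' i x) = V' i (g i x)"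
    and g_sym: "\<And>i A x. i \<in> I \<Longrightarrow> A \<in> symmetries i \<Longrightarrow> g i (A x) = A (g i x)"
    using bspec[OF all] by simp_all
  define G where "G x = (\<Sum>i\<in>I. P i (g i (P i x)))" for x
  have G_map: "G (A x) = A (G x)"
    if "bounded_linear A" "\<And>i. i \<in> I \<Longrightarrow> P i (g i (P i (A x))) = A (P i (g i (P i x)))" for A x
    using that by (simp add: G_def linear_sum[OF bounded_linear.linear])
  have "bounded_clinear G"
    unfolding bounded_clinear_def
  proof (intro conjI allI)
    show "bounded_linear G"
      unfolding G_def
      by (intro bounded_linear_sum bounded_linear_compose[OF P_bounded_linear]
          bounded_linear_compose[OF g] P_bounded_linear)
    show "G (d *\<^sub>C x) = d *\<^sub>C G x" for d x
      by (rule G_map[OF bounded_linear_scaleC]) (simp add: P_scaleC g_sym[OF _ symmetriesI(1)])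
  qed
  moreover have "norm (G x) \<le> c * norm x" for x
  proof (rule power2_le_imp_le)
    have "(norm (P i (g i (P i x))))\<^sup>2 \<le> (c * norm (P i x))\<^sup>2" if i: "i \<in> I" for i
      using power_mono[OF g_bound[OF i, of "P i x"], of 2] g_sym[OF i symmetriesI(2), of "P i x"]
      by (simp add: P_idem[OF i])
    then have "(norm (G x))\<^sup>2 \<le> (\<Sum>i\<in>I. (c * norm (P i x))\<^sup>2)"
      unfolding G_def norm_sum_P by (rule sum_mono)
    also have "\<dots> = c\<^sup>2 * (norm (\<Sum>i\<in>I. P i x))\<^sup>2"
      by (simp only: norm_sum_P power_mult_distrib sum_distrib_left)
    finally show "(norm (G x))\<^sup>2 \<le> (c * norm x)\<^sup>2" by (simp only: sum_P power_mult_distrib)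
    show "0 \<le> c * norm x" using c_nonneg by simp
  qed
  moreover have "G (\<pi> h) = \<pi> (Z h)" for h
    by (simp add: G_def g_\<pi> P_idem sum_P)
  moreover have "G (V' j x) = V' j (G x)" if j: "j \<in> I" for j x
  proof (rule G_map[OF V'_bounded_linear[OF j]])
    fix i assume i: "i \<in> I"
    have "g i (V' j (P i x)) = V' j (P i (g i (P i x)))"
    proof (cases "j = i")
      case True
      then show ?thesis using g_V'[OF i] g_sym[OF i symmetriesI(2), of "P i x"] by (simp add: P_idem[OF i])
    next
      case False
      then show ?thesis using g_sym[OF i symmetriesI(4)[OF j False], of "P i x"] by (simp add: P_idem[OF i])
    qed
    then show "P i (g i (P i (V' j x))) = V' j (P i (g i (P i x)))"
      by (simp add: P_V'_all[OF i j] P_idem[OF i])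
  qed
  ultimately show ?thesis by (intro exI[of _ G] conjI allI ballI)
qed

end

lemma foldr_tuple: "foldr (\<circ>) (map T w) id = foldr T w"
  by (induction w) (auto simp: id_def)

lemma tuple_prod_foldr: "tuple_prod n T = foldr T [1..<Suc n]"
  unfolding tuple_prod_def by (rule foldr_tuple)

lemma foldr_clinear:
  "(\<And>i. i \<in> set w \<Longrightarrow> bounded_clinear (T i)) \<Longrightarrow> bounded_clinear (foldr T w)"
proof (induction w)
  case (Cons j w)
  then show ?case by (auto simp: bounded_clinear_def o_def intro: bounded_linear_compose)
qed (simp add: bounded_clinear_def id_def bounded_linear_ident)

lemma foldr_adjoint:
  assumes "\<And>i x y. i \<in> set w \<Longrightarrow> inner (T i x) y = inner x (T' i y)"
  shows "inner (foldr T w x) y = inner x (fold T' w y)"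
  using assms by (induction w arbitrary: y) simp_all

lemma class_B0_isometric_tuple:
  fixes V :: "nat \<Rightarrow> 'k::chilbert_space \<Rightarrow> 'k"
  assumes V: "V \<in> class_B0 n" and iso: "\<forall>i\<in>{1..n}. linear_isometry (V i)"
  shows "pure_isometric_tuple [1..<Suc n] V (\<lambda>i. cadjoint (V i))"
proof -
  have idx: "set [1..<Suc n] = {1..n}" by auto
  have clin: "bounded_clinear (V i)" and nV: "norm (V i x) = norm x" if "i \<in> {1..n}" for i x
    using iso that by (auto simp: linear_isometry_def)
  have "cadjoint (tuple_prod n V) = fold (\<lambda>i. cadjoint (V i)) [1..<Suc n]"
    unfolding tuple_prod_foldr
    by (rule cadjoint_eqI, rule foldr_clinear, unfold idx, rule clin, assumption)
       (rule foldr_adjoint, unfold idx, rule inner_cadjoint, rule clin)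
  then have "(\<lambda>k. (fold (\<lambda>i. cadjoint (V i)) [1..<Suc n] ^^ k) x) \<longlonglongrightarrow> 0" for x
    using V unfolding class_B0_def pure_contraction_def by simp
  moreover have "V i (V j x) = V j (V i x)" if "i \<in> {1..n}" "j \<in> {1..n}" for i j x
    using V that unfolding class_B0_def commuting_tuple_def by (auto simp: fun_eq_iff)
  moreover have "x - V i (cadjoint (V i) x) - V j (cadjoint (V j) x)
      + V i (V j (cadjoint (V i) (cadjoint (V j) x))) = 0"
    if "i \<in> {1..n}" "j \<in> {1..n}" "i \<noteq> j" for i j x
    using V that unfolding class_B0_def by auto
  ultimately show ?thesis
    by (intro pure_isometric_tuple.intro) (simp_all only: idx distinct_upt clin nV inner_cadjoint)
qed

lemma cadjoint_commute:
  fixes A B :: "'a::chilbert_space \<Rightarrow> 'a"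
  assumes "bounded_clinear A" "bounded_clinear B" "A \<circ> B = B \<circ> A"
  shows "cadjoint A (cadjoint B x) = cadjoint B (cadjoint A x)"
proof (rule inner_eqI)
  fix y
  have "inner y (cadjoint A (cadjoint B x)) = inner (B (A y)) x"
    by (simp add: inner_cadjoint[OF assms(1), symmetric] inner_cadjoint[OF assms(2), symmetric])
  also have "B (A y) = A (B y)" using assms(3) by (metis comp_apply)
  also have "inner (A (B y)) x = inner y (cadjoint B (cadjoint A x))"
    by (simp add: inner_cadjoint[OF assms(1)] inner_cadjoint[OF assms(2)])
  finally show "inner (cadjoint A (cadjoint B x)) y = inner (cadjoint B (cadjoint A x)) y"
    by (simp add: inner_commute)
qed

theorem class_B0_commutant_lifting:
  fixes T :: "nat \<Rightarrow> 'h::chilbert_space \<Rightarrow> 'h" and V :: "nat \<Rightarrow> 'k::chilbert_space \<Rightarrow> 'k"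
  assumes T: "\<forall>i\<in>{1..n}. bounded_clinear (T i)" and V: "V \<in> class_B0 n"
    and dil: "isometric_dilation n T V \<pi>"
    and X: "bounded_clinear X" and XT: "\<forall>i\<in>{1..n}. X \<circ> T i = T i \<circ> X"
  shows "\<exists>Y. bounded_clinear Y \<and> \<pi> \<circ> cadjoint X = cadjoint Y \<circ> \<pi> \<and>
           (\<forall>i\<in>{1..n}. Y \<circ> V i = V i \<circ> Y) \<and> onorm Y = onorm X"
proof -
  have idx: "set [1..<Suc n] = {1..n}" by auto
  have iso: "\<forall>i\<in>{1..n}. linear_isometry (V i)" and \<pi>: "bounded_clinear \<pi>" "\<And>h. norm (\<pi> h) = norm h"
    and \<pi>T: "\<And>i h. i \<in> {1..n} \<Longrightarrow> \<pi> (cadjoint (T i) h) = cadjoint (V i) (\<pi> h)"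
    using dil unfolding isometric_dilation_def linear_isometry_def by (auto simp: fun_eq_iff)
  have V_clin: "bounded_clinear (V i)" if "i \<in> {1..n}" for i
    using iso that by (auto simp: linear_isometry_def)
  have XT': "cadjoint X (cadjoint (T i) h) = cadjoint (T i) (cadjoint X h)" if "i \<in> {1..n}" for i h
    using X T XT that by (intro cadjoint_commute) auto
  have "dilated_intertwiner [1..<Suc n] V (\<lambda>i. cadjoint (V i)) (\<lambda>i. cadjoint (T i)) \<pi> (cadjoint X) (onorm X)"
    by (intro dilated_intertwiner.intro dilated_intertwiner_axioms.intro class_B0_isometric_tuple V iso)
       (simp_all only: idx \<pi> \<pi>T XT' bounded_clinear_cadjoint[OF X] norm_cadjoint_le[OF X] onorm_nonneg[OF X])
  from dilated_intertwiner.intertwining_lift[OF this, unfolded idx]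
  obtain G where G: "bounded_clinear G" and G_bound: "\<And>x. norm (G x) \<le> onorm X * norm x"
    and G\<pi>: "\<And>h. G (\<pi> h) = \<pi> (cadjoint X h)"
    and GV: "\<And>i x. i \<in> {1..n} \<Longrightarrow> G (cadjoint (V i) x) = cadjoint (V i) (G x)"
    by blast
  define Y where "Y = cadjoint G"
  have Y: "bounded_clinear Y" unfolding Y_def by (rule bounded_clinear_cadjoint[OF G])
  have Y_adj: "inner (Y x) y = inner x (G y)" for x y
    using inner_cadjoint[OF G, of y x] by (simp add: Y_def inner_commute)
  have cY: "cadjoint Y = G" by (rule cadjoint_eqI[OF Y Y_adj])
  have "Y (V i x) = V i (Y x)" if i: "i \<in> {1..n}" for i x
    by (rule inner_eqI) (simp add: Y_adj inner_cadjoint[OF V_clin[OF i]] GV[OF i])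
  moreover have "onorm Y = onorm X"
  proof (rule antisym)
    have "norm (Y x) \<le> onorm X * norm x" for x
      by (rule norm_adjoint_le[where A = G]) (simp_all add: G_bound Y_def inner_cadjoint[OF G] onorm_nonneg[OF X])
    then show "onorm Y \<le> onorm X" by (rule onorm_bound[OF onorm_nonneg[OF X]])
    have "norm (cadjoint X h) \<le> onorm Y * norm h" for h
      using norm_cadjoint_le[OF Y, of "\<pi> h"] by (simp add: cY G\<pi> \<pi>(2))
    then have "norm (X x) \<le> onorm Y * norm x" for x
      by (rule norm_adjoint_le[where A = "cadjoint X"])
         (metis inner_cadjoint[OF X] inner_commute, rule onorm_nonneg[OF Y])
    then show "onorm X \<le> onorm Y" by (rule onorm_bound[OF onorm_nonneg[OF Y]])
  qed
  ultimately show ?thesis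
    using Y by (intro exI[of _ Y]) (auto simp: cY G\<pi> fun_eq_iff)
qed

theorem theorem1p2:
  fixes n :: nat
    and T :: "nat \<Rightarrow> 'h::chilbert_space \<Rightarrow> 'h"
    and \<Phi> :: "nat \<Rightarrow> complex \<Rightarrow> 'e::chilbert_space \<Rightarrow> 'e"
    and \<pi> :: "'h \<Rightarrow> 'e hardy"
    and X :: "'h \<Rightarrow> 'h"
  assumes "n \<ge> 2"
    and "separable_space (euclidean :: 'h topology)"
    and "separable_space (euclidean :: 'e topology)"
    and "T \<in> class_B0 n"
    and "bcl_tuple n \<Phi>"
    and "(\<lambda>i. mult_op (\<Phi> i)) \<in> class_B0 n"
    and "isometric_dilation n T (\<lambda>i. mult_op (\<Phi> i)) \<pi>"
    and "contraction X"
    and "\<forall>i\<in>{1..n}. X \<circ> T i = T i \<circ> X"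
  shows "\<exists>Y :: 'e hardy \<Rightarrow> 'e hardy. bounded_clinear Y \<and>
           \<pi> \<circ> cadjoint X = cadjoint Y \<circ> \<pi> \<and>
           (\<forall>i\<in>{1..n}. Y \<circ> mult_op (\<Phi> i) = mult_op (\<Phi> i) \<circ> Y) \<and>
           onorm Y = onorm X"
proof -
  have "\<forall>i\<in>{1..n}. bounded_clinear (T i)"
    using assms(4) by (auto simp: class_B0_def contraction_def)
  moreover have "bounded_clinear X" using assms(8) by (simp add: contraction_def)
  ultimately show ?thesis using assms(6,7,9) by (intro class_B0_commutant_lifting)
qed

end
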